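(* Let $n\ge1$, let $k\in\mathbb{Z}_{\ge0}$ and let $t=q^k$. Then $$(1,1)_{q,q^k}=\mathrm{ct}\left(\frac{1}{\Delta^X_\infty\Delta^X_0\Delta^{X^{-1}}_\infty}\right)=\prod_{i=2}^n\binom{ik}{k}_q$$ and $$\frac1{W_0(q^k)}(1,1)_{q,q^k}=\mathrm{ct}\left(\frac{1}{\Delta^X_\infty\Delta^X_0\Delta^{X^{-1}}_0\Delta^{X^{-1}}_\infty}\right)=\prod_{h=2}^{n}\binom{hk-1}{k-1}_q.$$
   Context: $\binom{a}{b}_q=\frac{(q;q)_a}{(q;q)_b(q;q)_{a-b}}$ is the $q$-binomial coefficient, where $(z;q)_k=\prod_{r=0}^{k-1}(1-q^rz)$; $\mathrm{ct}(f)$ is the constant term of $f$ in the variables $x_1,\ldots,x_n$; $W_0(t)=\sum_{w\in S_n}t^{\ell(w)}$ with $\ell$ the length function of the symmetric group $S_n$. Put $$\Delta_\infty^X=\prod_{1\le i<j\le n}\prod_{r\ge1}\frac{1-tq^rx_ix_j^{-1}}{1-q^rx_ix_j^{-1}},\qquad \Delta_0^{X}=\prod_{1\le i<j\le n}\frac{1-tx_ix_j^{-1}}{1-x_ix_j^{-1}},$$ and let $\Delta_\infty^{X^{-1}},\Delta_0^{X^{-1}}$ be obtained from these by replacing each $x_i$ by $x_i^{-1}$. For $t=q^k$ one has $\frac{1}{\Delta^X_\infty\Delta^X_0\Delta^{X^{-1}}_\infty}=\prod_{i<j}(x_ix_j^{-1};q)_k(qx_i^{-1}x_j;q)_k$ and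 $\frac1{\Delta^X_\infty\Delta^X_0\Delta^{X^{-1}}_0\Delta^{X^{-1}}_\infty}=\prod_{i<j}(x_ix_j^{-1};q)_k(x_i^{-1}x_j;q)_k$, which are Laurent polynomials. The inner product is $(f_1,f_2)_{q,t}=\mathrm{ct}\Big(\frac{f_1\overline{f_2}}{\Delta^X_\infty\Delta^X_0\Delta^{X^{-1}}_\infty}\Big)$, where $\overline{f}(x_1,\ldots,x_n;q,t)=f(x_1^{-1},\ldots,x_n^{-1};q^{-1},t^{-1})$, and $(\,,)_{q,q^k}$ is its value at $t=q^k$.
   Formalization: In the second display the middle constant term carries a factor 1/n!, without which it is false for n≥2 (n=2, k=1 gives 1, 2, 1); its last equality is stated for k≥1, as the binomial is undefined at k=0; q is complex with 0<|q|<1. *)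

theory Defs
  imports "HOL-Analysis.Analysis" "HOL-Combinatorics.Combinatorics"
begin

text \<open>
  The variables are \<open>x 1, \<dots>, x n\<close> for a point \<open>x :: nat \<Rightarrow> complex\<close>, and \<open>q\<close>, \<open>t\<close> are complex
  numbers. The infinite products below converge for \<open>norm q < 1\<close>.
\<close>

definition qpoch :: "complex \<Rightarrow> complex \<Rightarrow> nat \<Rightarrow> complex" where
  "qpoch z q k = (\<Prod>r<k. 1 - q ^ r * z)"

text \<open>Only meaningful for \<open>b \<le> a\<close>, because of the truncated subtraction.\<close>

definition qbinom :: "complex \<Rightarrow> nat \<Rightarrow> nat \<Rightarrow> complex" where
  "qbinom q a b = qpoch q q a / (qpoch q q b * qpoch q q (a - b))"

text \<open>
  Coxeter length on the symmetric group of \<open>{1..n}\<close>: the least length of an expression as a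
  product of simple transpositions \<open>(i, i + 1)\<close> with \<open>1 \<le> i < n\<close>.
\<close>

definition perm_length :: "nat \<Rightarrow> (nat \<Rightarrow> nat) \<Rightarrow> nat" where
  "perm_length n w =
     (LEAST m. \<exists>is. length is = m \<and> set is \<subseteq> {1..<n} \<and>
                    w = foldr (\<lambda>i v. Transposition.transpose i (Suc i) \<circ> v) is id)"

definition W0 :: "nat \<Rightarrow> complex \<Rightarrow> complex" where
  "W0 n t = (\<Sum>w | w permutes {1..n}. t ^ perm_length n w)"

definition Delta_inf :: "nat \<Rightarrow> complex \<Rightarrow> complex \<Rightarrow> (nat \<Rightarrow> complex) \<Rightarrow> complex" where
  "Delta_inf n q t x =
     (\<Prod>(i, j) | 1 \<le> i \<and> i < j \<and> j \<le> n.
        \<Prod>r. (1 - t * q ^ Suc r * x i * inverse (x j)) / (1 - q ^ Suc r * x i * inverse (x j)))"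

definition Delta_0 :: "nat \<Rightarrow> complex \<Rightarrow> (nat \<Rightarrow> complex) \<Rightarrow> complex" where
  "Delta_0 n t x =
     (\<Prod>(i, j) | 1 \<le> i \<and> i < j \<and> j \<le> n.
        (1 - t * x i * inverse (x j)) / (1 - x i * inverse (x j)))"

abbreviation inv_vars :: "(nat \<Rightarrow> complex) \<Rightarrow> nat \<Rightarrow> complex" where
  "inv_vars x \<equiv> (\<lambda>i. inverse (x i))"

text \<open>
  \<open>c\<close> is the family of coefficients of a Laurent expansion of \<open>f\<close> in \<open>x 1, \<dots>, x n\<close>, absolutely
  convergent on the unit torus. Finitely supported \<open>c\<close> are Laurent polynomials; infinite
  support is needed for the weight of the inner product at general \<open>t\<close>. Points with
  \<open>x i = x j\<close> for some \<open>i \<noteq> j\<close> are left out because the quotients in \<open>Delta_0\<close> have the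
  junk value 0 there. The remaining points are dense in the torus, so \<open>c\<close> is
  determined by \<open>f\<close>.
\<close>

definition laurent_expansion ::
    "nat \<Rightarrow> ((nat \<Rightarrow> complex) \<Rightarrow> complex) \<Rightarrow> ((nat \<Rightarrow> int) \<Rightarrow> complex) \<Rightarrow> bool" where
  "laurent_expansion n f c \<longleftrightarrow>
     (\<forall>x. (\<forall>i\<in>{1..n}. norm (x i) = 1) \<and> inj_on x {1..n} \<longrightarrow>
        ((\<lambda>a. c a * (\<Prod>i=1..n. x i powi a i)) has_sum f x) {a. \<forall>i. i \<notin> {1..n} \<longrightarrow> a i = 0})"

definition ct :: "nat \<Rightarrow> ((nat \<Rightarrow> complex) \<Rightarrow> complex) \<Rightarrow> complex" where
  "ct n f = (THE z. \<exists>c. laurent_expansion n f c \<and> z = c (\<lambda>_. 0))"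

text \<open>
  The arguments of the inner product depend on \<open>x\<close>, \<open>q\<close> and \<open>t\<close>, since the involution
  inverts all of them.
\<close>

type_synonym qt_fun = "(nat \<Rightarrow> complex) \<Rightarrow> complex \<Rightarrow> complex \<Rightarrow> complex"

definition bar :: "qt_fun \<Rightarrow> qt_fun" where
  "bar f x q t = f (inv_vars x) (inverse q) (inverse t)"

definition qt_inner :: "nat \<Rightarrow> complex \<Rightarrow> complex \<Rightarrow> qt_fun \<Rightarrow> qt_fun \<Rightarrow> complex" where
  "qt_inner n q t f1 f2 =
     ct n (\<lambda>x. f1 x q t * bar f2 x q t /
                 (Delta_inf n q t x * Delta_0 n t x * Delta_inf n q t (inv_vars x)))"

end

theory Submission
  imports Defs
begin

text \<open>
  For \<open>t = q^k\<close> the weights are products of factors \<open>1 - u x\<^sub>i / x\<^sub>j\<close>, homogeneous of degree 0, in which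
  no variable occurs with exponent below \<open>-d\<close>, where \<open>d = (n - 1) k\<close>. Following the proof of the
  q-Dyson identity by Karolyi and Nagy, Lagrange interpolation in every variable expresses the
  constant term as a weighted sum of the values of the weight at the points
  \<open>(q^s\<^sub>1, \<dots>, q^s\<^sub>n)\<close> with \<open>0 \<le> s\<^sub>i \<le> d\<close>. The zeros of the weight force the \<open>s\<^sub>i\<close> to be at least
  \<open>k\<close> apart, so that \<open>s\<^sub>i = k (p i - 1)\<close> for a permutation \<open>p\<close>. For the symmetric weight all \<open>n!\<close>
  permutations contribute equally; for the other weight only the identity survives.
\<close>

section \<open>Constant terms\<close>

definition exponents :: "nat \<Rightarrow> (nat \<Rightarrow> int) set" where
  "exponents n = {a. \<forall>i. i \<notin> {1..n} \<longrightarrow> a i = 0}"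

definition monom_at :: "nat \<Rightarrow> (nat \<Rightarrow> complex) \<Rightarrow> (nat \<Rightarrow> int) \<Rightarrow> complex" where
  "monom_at n x a = (\<Prod>i=1..n. x i powi a i)"

lemma zero_in_exponents: "(\<lambda>_. 0) \<in> exponents n"
  by (simp add: exponents_def)

lemma monom_at_zero [simp]: "monom_at n x (\<lambda>_. 0) = 1"
  by (simp add: monom_at_def)

lemma laurent_expansion_iff:
  "laurent_expansion n f c \<longleftrightarrow>
     (\<forall>x. (\<forall>i\<in>{1..n}. norm (x i) = 1) \<and> inj_on x {1..n} \<longrightarrow>
        ((\<lambda>a. c a * monom_at n x a) has_sum f x) (exponents n))"
  by (simp add: laurent_expansion_def exponents_def monom_at_def)

lemma norm_monom_at:
  assumes "\<And>i. i \<in> {1..n} \<Longrightarrow> norm (x i) = 1"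
  shows "norm (monom_at n x a) = 1"
  unfolding monom_at_def prod_norm [symmetric]
  by (rule prod.neutral) (simp add: norm_power_int assms)

lemma has_sum_sum_index:
  fixes f :: "'i \<Rightarrow> 'a \<Rightarrow> 'b::{topological_comm_monoid_add}"
  assumes "finite I" "\<And>i. i \<in> I \<Longrightarrow> (f i has_sum s i) A"
  shows "((\<lambda>a. \<Sum>i\<in>I. f i a) has_sum (\<Sum>i\<in>I. s i)) A"
  using assms by (induction I rule: finite_induct) (auto intro: has_sum_add)

lemma sum_root_of_unity_powi_eq_0:
  fixes m :: int
  assumes "m \<noteq> 0" "\<bar>m\<bar> < int N"
  shows "(\<Sum>j<N. (cis (2 * pi * real j / real N)) powi m) = 0"
proof -
  define z where "z = cis (2 * pi / real N)"
  have N: "N > 0" using assms by simp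
  have zj: "cis (2 * pi * real j / real N) = z ^ j" for j
    by (simp add: z_def Complex.DeMoivre mult_ac)
  have zN: "z ^ N = 1" using N zj[of N] by simp
  have "z \<noteq> 0" by (simp add: z_def)
  define k where "k = nat \<bar>m\<bar>"
  have k: "0 < k" "k < N" using assms by (auto simp: k_def)
  have "z ^ k \<noteq> 1"
  proof
    assume "z ^ k = 1"
    hence eq: "cis (2 * pi * real k / real N) = cis (2 * pi * real 0 / real N)"
      using zj[of k] by simp
    have inj: "inj_on (\<lambda>k. cis (2 * pi * real k / real N)) {..<N}"
      using Complex.bij_betw_roots_unity[OF N] by (rule bij_betw_imp_inj_on)
    have "k = 0" by (rule inj_onD[OF inj eq]) (use k in auto)
    with k show False by simp
  qed
  hence ne: "z powi m \<noteq> 1"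
  proof (cases "m \<ge> 0")
    case False
    hence "z powi m = inverse (z ^ k)" by (simp add: k_def power_int_def power_inverse)
    thus ?thesis using \<open>z ^ k \<noteq> 1\<close> by (simp only: inverse_eq_1_iff simp_thms)
  qed (simp add: k_def power_int_def)
  have "(\<Sum>j<N. (cis (2 * pi * real j / real N)) powi m) = (\<Sum>j<N. (z powi m) ^ j)"
    unfolding zj by (rule sum.cong) (simp_all add: power_int_power power_int_power' mult.commute)
  also have "\<dots> = ((z powi m) ^ N - 1) / (z powi m - 1)"
    using ne by (rule geometric_sum)
  also have "(z powi m) ^ N = (z ^ N) powi m"
    by (simp add: power_int_power power_int_power' mult.commute)
  also have "\<dots> = 1" by (simp add: zN)
  finally show ?thesis by simp
qed

text \<open>The offset by \<open>i / (N (n + 1))\<close> of a turn keeps the coordinates distinct, as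
  \<open>laurent_expansion\<close> requires.\<close>

definition torus_pt :: "nat \<Rightarrow> nat \<Rightarrow> (nat \<Rightarrow> nat) \<Rightarrow> nat \<Rightarrow> complex" where
  "torus_pt n N J i =
     cis (2 * pi * real i / real (N * Suc n)) * cis (2 * pi * real (J i) / real N)"

lemma norm_torus_pt: "norm (torus_pt n N J i) = 1"
  by (simp add: torus_pt_def norm_mult)

lemma inj_on_torus_pt:
  assumes "N > 0" "\<And>i. i \<in> {1..n} \<Longrightarrow> J i < N"
  shows "inj_on (torus_pt n N J) {1..n}"
proof
  fix i i' assume i: "i \<in> {1..n}" and i': "i' \<in> {1..n}" and eq: "torus_pt n N J i = torus_pt n N J i'"
  define M where "M = N * Suc n"
  have M: "M > 0" using assms by (simp add: M_def)
  have pt: "torus_pt n N J l = cis (2 * pi * real (l + Suc n * J l) / real M)" for l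
  proof -
    have "2 * pi * real (Suc n * J l) / real M = 2 * pi * real (J l) / real N"
      using assms(1) by (simp only: M_def of_nat_mult) (simp add: field_simps del: of_nat_Suc)
    thus ?thesis
      by (simp add: torus_pt_def cis_mult M_def distrib_left add_divide_distrib del: of_nat_Suc)
  qed
  have less: "l + Suc n * J l < M" if "l \<in> {1..n}" for l
  proof -
    have "l + Suc n * J l < Suc n * (J l + 1)" using that by simp
    also have "\<dots> \<le> Suc n * N" using assms(2)[OF that] by (intro mult_le_mono2) simp
    finally show ?thesis by (simp add: M_def mult.commute)
  qed
  have "inj_on (\<lambda>k. cis (2 * pi * real k / real M)) {..<M}"
    using Complex.bij_betw_roots_unity[OF M] by (rule bij_betw_imp_inj_on)
  hence "i + Suc n * J i = i' + Suc n * J i'"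
    by (rule inj_onD) (use eq less[OF i] less[OF i'] in \<open>simp_all only: pt lessThan_iff\<close>)
  hence "(i + Suc n * J i) mod Suc n = (i' + Suc n * J i') mod Suc n" by simp
  thus "i = i'" using i i' by (simp only: mod_mult_self2) simp
qed

text \<open>Averaging over these points kills every exponent vector with an entry \<open>0 < \<bar>a i\<bar> < N\<close>,
  so the zeroth coefficient is bounded by the tail of the absolutely convergent series.\<close>

lemma expansion_of_zero:
  assumes c: "\<And>x. (\<forall>i\<in>{1..n}. norm (x i) = 1) \<Longrightarrow> inj_on x {1..n} \<Longrightarrow>
                 ((\<lambda>a. c a * monom_at n x a) has_sum 0) (exponents n)"
  shows "c (\<lambda>_. 0) = 0"
proof -
  define P where "P N = PiE {1..n} (\<lambda>_. {..<N})" for N :: nat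
  define g where "g N a = (\<Sum>J\<in>P N. c a * monom_at n (torus_pt n N J) a) / of_nat (N ^ n)" for N a
  have finP: "finite (P N)" for N by (auto simp: P_def intro: finite_PiE)
  have cardP: "card (P N) = N ^ n" for N by (simp add: P_def card_PiE)
  have pt: "(\<forall>i\<in>{1..n}. norm (torus_pt n N J i) = 1)" "inj_on (torus_pt n N J) {1..n}"
    if "N > 0" "J \<in> P N" for N J
    using that by (auto simp: norm_torus_pt P_def PiE_iff simp del: One_nat_def intro!: inj_on_torus_pt)
  have g0: "g N (\<lambda>_. 0) = c (\<lambda>_. 0)" if "N > 0" for N
    using that by (simp add: g_def cardP)
  have gsum: "(g N has_sum 0) (exponents n)" if "N > 0" for N
  proof -
    have "((\<lambda>a. \<Sum>J\<in>P N. c a * monom_at n (torus_pt n N J) a) has_sum (\<Sum>J\<in>P N. 0)) (exponents n)"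
      by (intro has_sum_sum_index finP c pt that)
    hence "((\<lambda>a. (\<Sum>J\<in>P N. c a * monom_at n (torus_pt n N J) a) * inverse (of_nat (N ^ n)))
             has_sum ((\<Sum>J\<in>P N. 0) * inverse (of_nat (N ^ n)))) (exponents n)"
      by (rule has_sum_cmult_left)
    thus ?thesis unfolding g_def divide_inverse by (simp only: sum.neutral_const mult_zero_left)
  qed
  have gnorm: "norm (g N a) \<le> norm (c a)" if "N > 0" for N a
  proof -
    have "norm (\<Sum>J\<in>P N. c a * monom_at n (torus_pt n N J) a) \<le> (\<Sum>J\<in>P N. norm (c a))"
      by (rule order_trans[OF norm_sum], rule sum_mono)
         (simp add: norm_mult norm_monom_at norm_torus_pt)
    also have "\<dots> = real (N ^ n) * norm (c a)" by (simp add: cardP)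
    finally show ?thesis using that by (simp add: g_def norm_divide field_simps norm_power)
  qed
  have gz: "g N a = 0" if "i \<in> {1..n}" "a i \<noteq> 0" "\<bar>a i\<bar> < int N" for N a i
  proof -
    have "(\<Sum>J\<in>P N. monom_at n (torus_pt n N J) a) =
          (\<Sum>J\<in>P N. \<Prod>l=1..n. (cis (2 * pi * real l / real (N * Suc n)) powi a l *
             (cis (2 * pi * real (J l) / real N)) powi a l))"
      by (simp add: monom_at_def torus_pt_def power_int_mult_distrib)
    also have "\<dots> = (\<Prod>l=1..n. \<Sum>j<N. (cis (2 * pi * real l / real (N * Suc n)) powi a l *
             (cis (2 * pi * real j / real N)) powi a l))"
      unfolding P_def by (rule prod_sum_PiE [symmetric]) auto
    also have "\<dots> = 0"
    proof (intro prod_zero bexI[of _ i])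
      show "(\<Sum>j<N. cis (2 * pi * real i / real (N * Suc n)) powi a i *
              (cis (2 * pi * real j / real N)) powi a i) = 0"
        unfolding sum_distrib_left [symmetric] sum_root_of_unity_powi_eq_0[OF that(2,3)]
        by (rule mult_zero_right)
    qed (use that in simp_all)
    finally have "(\<Sum>J\<in>P N. monom_at n (torus_pt n N J) a) = 0" .
    thus ?thesis unfolding g_def sum_distrib_left [symmetric] by simp
  qed
  have "((\<lambda>a. c a * monom_at n (torus_pt n 1 (restrict (\<lambda>_. 0) {1..n})) a) has_sum 0) (exponents n)"
    by (intro c pt) (auto simp: P_def)
  hence "(\<lambda>a. norm (c a * monom_at n (torus_pt n 1 (restrict (\<lambda>_. 0) {1..n})) a)) summable_on exponents n"
    by (simp only: summable_on_iff_abs_summable_on_complex [symmetric]) (rule has_sum_imp_summable)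
  hence summ: "(\<lambda>a. norm (c a)) summable_on exponents n"
    by (simp add: norm_mult norm_monom_at norm_torus_pt)
  define S where "S = infsum (\<lambda>a. norm (c a)) (exponents n)"
  have hS: "((\<lambda>a. norm (c a)) has_sum S) (exponents n)"
    using summ unfolding S_def by simp
  have "norm (c (\<lambda>_. 0)) \<le> e" if e: "e > 0" for e
  proof -
    obtain F0 where F0: "finite F0" "F0 \<subseteq> exponents n" "dist (sum (\<lambda>a. norm (c a)) F0) S \<le> e"
      using has_sum_finite_approximation[OF hS e] by blast
    define F where "F = insert (\<lambda>_. 0) F0"
    have F: "finite F" "F \<subseteq> exponents n" "(\<lambda>_. 0) \<in> F"
      using F0 by (auto simp: F_def zero_in_exponents)
    have "S \<le> (\<Sum>a\<in>F0. norm (c a)) + e" using F0(3) by (simp add: dist_real_def)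
    also have "(\<Sum>a\<in>F0. norm (c a)) \<le> (\<Sum>a\<in>F. norm (c a))"
      using F(1) by (intro sum_mono2) (auto simp: F_def)
    finally have SF: "S \<le> (\<Sum>a\<in>F. norm (c a)) + e" by simp
    define N where "N = Suc (\<Sum>a\<in>F. \<Sum>i=1..n. nat \<bar>a i\<bar>)"
    have N0: "N > 0" by (simp add: N_def)
    have less: "\<bar>a i\<bar> < int N" if "a \<in> F" "i \<in> {1..n}" for a i
    proof -
      have "nat \<bar>a i\<bar> \<le> (\<Sum>i=1..n. nat \<bar>a i\<bar>)" using that by (intro member_le_sum) auto
      also have "\<dots> \<le> (\<Sum>a\<in>F. \<Sum>i=1..n. nat \<bar>a i\<bar>)"
        by (rule member_le_sum[of a F "\<lambda>a. \<Sum>i=1..n. nat \<bar>a i\<bar>"]) (use that F in auto)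
      finally have "nat \<bar>a i\<bar> < N" unfolding N_def by (rule le_imp_less_Suc)
      thus ?thesis by linarith
    qed
    have z: "g N a = 0" if a: "a \<in> F" "a \<noteq> (\<lambda>_. 0)" for a
    proof -
      from a(2) obtain i where i: "a i \<noteq> 0" by auto
      have "i \<in> {1..n}" using F(2) a(1) i unfolding exponents_def by blast
      thus ?thesis using i less[OF a(1)] by (intro gz) auto
    qed
    have "sum (g N) F = (\<Sum>a\<in>{\<lambda>_. 0}. g N a)"
      by (rule sum.mono_neutral_right) (use F z in auto)
    hence "sum (g N) F = c (\<lambda>_. 0)" using g0[OF N0] by simp
    hence h1: "(g N has_sum (0 - c (\<lambda>_. 0))) (exponents n - F)"
      by (intro has_sum_Diff gsum N0 has_sum_finiteI F) auto
    have h2: "((\<lambda>a. norm (c a)) has_sum (S - (\<Sum>a\<in>F. norm (c a)))) (exponents n - F)"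
      by (intro has_sum_Diff hS has_sum_finiteI F) auto
    have "norm (0 - c (\<lambda>_. 0)) \<le> S - (\<Sum>a\<in>F. norm (c a))"
      using norm_infsum_le[OF h1 h2] gnorm[OF N0] by blast
    with SF show ?thesis by simp
  qed
  hence "norm (c (\<lambda>_. 0)) \<le> 0" by (rule field_le_epsilon) simp
  thus ?thesis by simp
qed

lemma ct_eqI:
  assumes "laurent_expansion n f c"
  shows "ct n f = c (\<lambda>_. 0)"
  unfolding ct_def
proof (rule the_equality)
  show "\<exists>c'. laurent_expansion n f c' \<and> c (\<lambda>_. 0) = c' (\<lambda>_. 0)" using assms by blast
next
  fix z assume "\<exists>c'. laurent_expansion n f c' \<and> z = c' (\<lambda>_. 0)"
  then obtain c' where c': "laurent_expansion n f c'" "z = c' (\<lambda>_. 0)" by blast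
  have "(\<lambda>a. c' a - c a) (\<lambda>_. 0) = 0"
  proof (rule expansion_of_zero)
    fix x :: "nat \<Rightarrow> complex" assume x: "\<forall>i\<in>{1..n}. norm (x i) = 1" "inj_on x {1..n}"
    have "((\<lambda>a. c' a * monom_at n x a) has_sum f x) (exponents n)"
         "((\<lambda>a. c a * monom_at n x a) has_sum f x) (exponents n)"
      using assms c' x by (auto simp: laurent_expansion_iff)
    moreover from this(2) have "((\<lambda>a. - (c a * monom_at n x a)) has_sum - f x) (exponents n)"
      by (simp add: has_sum_uminus)
    ultimately have "((\<lambda>a. c' a * monom_at n x a + - (c a * monom_at n x a)) has_sum (f x + - f x)) (exponents n)"
      by (intro has_sum_add)
    thus "((\<lambda>a. (c' a - c a) * monom_at n x a) has_sum 0) (exponents n)"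
      by (simp add: algebra_simps)
  qed
  thus "z = c (\<lambda>_. 0)" using c' by simp
qed

lemma ct_cong:
  assumes "\<And>x. (\<forall>i\<in>{1..n}. norm (x i) = 1) \<Longrightarrow> inj_on x {1..n} \<Longrightarrow> f x = g x"
  shows "ct n f = ct n g"
proof -
  have "laurent_expansion n f = laurent_expansion n g"
    using assms by (auto simp: laurent_expansion_def fun_eq_iff)
  thus ?thesis by (simp add: ct_def)
qed

section \<open>The length generating function of the symmetric group\<close>

definition inversions :: "nat \<Rightarrow> (nat \<Rightarrow> nat) \<Rightarrow> (nat \<times> nat) set" where
  "inversions n w = {(a, b). a \<in> {1..n} \<and> b \<in> {1..n} \<and> a < b \<and> w a > w b}"

definition word_perm :: "nat list \<Rightarrow> nat \<Rightarrow> nat" where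
  "word_perm is = foldr (\<lambda>i v. Transposition.transpose i (Suc i) \<circ> v) is id"

lemma word_perm_Nil [simp]: "word_perm [] = id"
  and word_perm_Cons [simp]: "word_perm (i # is) = Transposition.transpose i (Suc i) \<circ> word_perm is"
  by (simp_all add: word_perm_def)

lemma word_perm_append: "word_perm (xs @ ys) = word_perm xs \<circ> word_perm ys"
  by (induction xs) (auto simp: comp_assoc)

lemma word_perm_permutes: "set is \<subseteq> {1..<n} \<Longrightarrow> word_perm is permutes {1..n}"
proof (induction "is")
  case (Cons i "is")
  have "Transposition.transpose i (Suc i) permutes {1..n}"
    using Cons.prems by (intro permutes_swap_id) auto
  thus ?case unfolding word_perm_Cons using Cons by (intro permutes_compose) auto
qed (simp add: permutes_id)

lemma finite_inversions [simp]: "finite (inversions n w)"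
  by (rule finite_subset[of _ "{1..n} \<times> {1..n}"]) (auto simp: inversions_def)

lemma inversions_id [simp]: "inversions n id = {}"
  by (auto simp: inversions_def)

lemma card_inversions_transpose_le:
  assumes "v permutes {1..n}"
  shows "card (inversions n (Transposition.transpose i (Suc i) \<circ> v)) \<le> Suc (card (inversions n v))"
proof -
  have "inversions n (Transposition.transpose i (Suc i) \<circ> v) \<subseteq>
          insert (inv v i, inv v (Suc i)) (inversions n v)"
  proof clarify
    fix a b assume ab: "(a, b) \<in> inversions n (Transposition.transpose i (Suc i) \<circ> v)"
      and "(a, b) \<notin> inversions n v"
    hence "v a \<le> v b" by (auto simp: inversions_def)
    moreover have "v a \<noteq> v b"
      using ab permutes_inj[OF assms] by (auto simp: inversions_def dest: injD)
    ultimately have "v a = i \<and> v b = Suc i"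
      using ab by (auto simp: inversions_def Transposition.transpose_def split: if_splits)
    thus "a = inv v i \<and> b = inv v (Suc i)"
      using permutes_inverses[OF assms] by metis
  qed
  hence "card (inversions n (Transposition.transpose i (Suc i) \<circ> v)) \<le>
           card (insert (inv v i, inv v (Suc i)) (inversions n v))"
    by (intro card_mono) auto
  also have "\<dots> \<le> Suc (card (inversions n v))" by (rule card_insert_le_m1) auto
  finally show ?thesis .
qed

lemma card_inversions_word_perm_le:
  "set is \<subseteq> {1..<n} \<Longrightarrow> card (inversions n (word_perm is)) \<le> length is"
proof (induction "is")
  case (Cons i "is")
  have "card (inversions n (word_perm (i # is))) \<le> Suc (card (inversions n (word_perm is)))"
    using Cons.prems by (auto intro!: card_inversions_transpose_le word_perm_permutes)
  also have "\<dots> \<le> length (i # is)" using Cons by simp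
  finally show ?case .
qed simp

definition top_cycle :: "nat \<Rightarrow> nat \<Rightarrow> nat \<Rightarrow> nat" where
  "top_cycle n m = word_perm [m..<Suc n]"

lemma top_cycle_eq:
  assumes "m \<le> Suc n"
  shows "top_cycle n m j = (if j = Suc n then m else if m \<le> j \<and> j \<le> n then Suc j else j)"
  using assms unfolding top_cycle_def
proof (induction "Suc n - m" arbitrary: m)
  case 0
  thus ?case by auto
next
  case (Suc d)
  hence "[m..<Suc n] = m # [Suc m..<Suc n]" by (simp add: upt_conv_Cons del: upt_Suc)
  thus ?case using Suc(1)[of "Suc m"] Suc(2,3)
    by (auto simp: Transposition.transpose_def simp del: upt_Suc)
qed

lemma top_cycle_permutes: "1 \<le> m \<Longrightarrow> top_cycle n m permutes {1..Suc n}"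
  unfolding top_cycle_def by (rule word_perm_permutes) auto

lemma bij_betw_top_cycle:
  "bij_betw (\<lambda>(m, v). top_cycle n m \<circ> v) ({1..Suc n} \<times> {v. v permutes {1..n}})
     {w. w permutes {1..Suc n}}"
proof (rule bij_betw_byWitness[where f' = "\<lambda>w. (w (Suc n), inv (top_cycle n (w (Suc n))) \<circ> w)"])
  have last: "(top_cycle n m \<circ> v) (Suc n) = m" if "m \<in> {1..Suc n}" "v permutes {1..n}" for m v
    using that permutes_not_in[of v "{1..n}" "Suc n"] by (simp add: top_cycle_eq)
  show "\<forall>p\<in>{1..Suc n} \<times> {v. v permutes {1..n}}.
          (\<lambda>w. (w (Suc n), inv (top_cycle n (w (Suc n))) \<circ> w)) ((\<lambda>(m, v). top_cycle n m \<circ> v) p) = p"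
  proof (rule ballI)
    fix p assume "p \<in> {1..Suc n} \<times> {v. v permutes {1..n}}"
    then obtain m v where p: "p = (m, v)" and mv: "m \<in> {1..Suc n}" "v permutes {1..n}" by blast
    have "top_cycle n m permutes {1..Suc n}" using mv by (intro top_cycle_permutes) simp
    hence "inv (top_cycle n m) \<circ> (top_cycle n m \<circ> v) = v"
      by (simp add: fun_eq_iff permutes_inverses)
    thus "(\<lambda>w. (w (Suc n), inv (top_cycle n (w (Suc n))) \<circ> w)) ((\<lambda>(m, v). top_cycle n m \<circ> v) p) = p"
      by (simp only: p split last[OF mv])
  qed
  show "\<forall>w\<in>{w. w permutes {1..Suc n}}. (\<lambda>(m, v). top_cycle n m \<circ> v)
           (w (Suc n), inv (top_cycle n (w (Suc n))) \<circ> w) = w"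
  proof (rule ballI)
    fix w assume "w \<in> {w. w permutes {1..Suc n}}"
    hence w: "w permutes {1..Suc n}" by simp
    have "w (Suc n) \<in> {1..Suc n}" using w by (simp add: permutes_in_image del: atLeastAtMost_iff) simp
    hence "top_cycle n (w (Suc n)) permutes {1..Suc n}" by (intro top_cycle_permutes) simp
    thus "(\<lambda>(m, v). top_cycle n m \<circ> v) (w (Suc n), inv (top_cycle n (w (Suc n))) \<circ> w) = w"
      by (simp add: fun_eq_iff permutes_inverses)
  qed
  show "(\<lambda>(m, v). top_cycle n m \<circ> v) ` ({1..Suc n} \<times> {v. v permutes {1..n}}) \<subseteq> {w. w permutes {1..Suc n}}"
    by (auto simp del: One_nat_def intro!: permutes_compose top_cycle_permutes elim: permutes_subset)
  show "(\<lambda>w. (w (Suc n), inv (top_cycle n (w (Suc n))) \<circ> w)) ` {w. w permutes {1..Suc n}} \<subseteq>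
          {1..Suc n} \<times> {v. v permutes {1..n}}"
  proof (rule image_subsetI)
    fix w assume "w \<in> {w. w permutes {1..Suc n}}"
    hence w: "w permutes {1..Suc n}" by simp
    have m: "w (Suc n) \<in> {1..Suc n}" using w by (simp add: permutes_in_image del: atLeastAtMost_iff) simp
    let ?c = "top_cycle n (w (Suc n))"
    have c: "?c permutes {1..Suc n}" using m by (intro top_cycle_permutes) simp
    have "?c (Suc n) = w (Suc n)" using m by (simp add: top_cycle_eq)
    hence fix_last: "(inv ?c \<circ> w) (Suc n) = Suc n" using permutes_inverses(2)[OF c] by (metis comp_apply)
    have "inv ?c \<circ> w permutes {1..Suc n}" using w c by (intro permutes_compose permutes_inv)
    hence "inv ?c \<circ> w permutes {1..n}"
      by (rule permutes_superset) (use fix_last in \<open>auto simp: le_Suc_eq\<close>)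
    with m show "(w (Suc n), inv ?c \<circ> w) \<in> {1..Suc n} \<times> {v. v permutes {1..n}}" by blast
  qed
qed

lemma card_inversions_top_cycle:
  assumes m: "m \<in> {1..Suc n}" and v: "v permutes {1..n}"
  shows "card (inversions (Suc n) (top_cycle n m \<circ> v)) = card (inversions n v) + (Suc n - m)"
proof -
  let ?w = "top_cycle n m \<circ> v"
  have vn: "v (Suc n) = Suc n" using v by (auto intro: permutes_not_in)
  have vin: "v a \<in> {1..n}" if "a \<in> {1..n}" for a
    using that v by (simp only: permutes_in_image)
  have mono: "?w a > ?w b \<longleftrightarrow> v a > v b" if "a \<in> {1..n}" "b \<in> {1..n}" for a b
    using vin[OF that(1)] vin[OF that(2)] m by (auto simp: top_cycle_eq)
  have last: "?w a > ?w (Suc n) \<longleftrightarrow> v a \<in> {m..n}" if "a \<in> {1..n}" for a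
    using vin[OF that] m vn by (auto simp: top_cycle_eq)
  have "inversions (Suc n) ?w = inversions n v \<union> (\<lambda>a. (a, Suc n)) ` {a\<in>{1..n}. v a \<in> {m..n}}" (is "_ = _ \<union> ?B")
  proof (intro set_eqI iffI; clarify)
    fix a b assume ab: "(a, b) \<in> inversions (Suc n) ?w" and nB: "(a, b) \<notin> ?B"
    hence a: "a \<in> {1..n}" by (auto simp: inversions_def)
    show "(a, b) \<in> inversions n v"
    proof (cases "b = Suc n")
      case True
      with ab nB last[OF a] a show ?thesis by (auto simp: inversions_def)
    next
      case False
      hence "b \<in> {1..n}" using ab by (auto simp: inversions_def)
      with ab a mono[OF a this] show ?thesis by (auto simp: inversions_def)
    qed
  next
    fix a b assume "(a, b) \<in> inversions n v \<union> ?B"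
    thus "(a, b) \<in> inversions (Suc n) ?w"
    proof
      assume ab: "(a, b) \<in> inversions n v"
      hence "a \<in> {1..n}" "b \<in> {1..n}" by (auto simp: inversions_def)
      with ab mono[OF this] show ?thesis by (auto simp: inversions_def)
    next
      assume "(a, b) \<in> ?B"
      hence "b = Suc n" "a \<in> {1..n}" "v a \<in> {m..n}" by auto
      with last[of a] show ?thesis by (auto simp: inversions_def)
    qed
  qed
  moreover have "inversions n v \<inter> ?B = {}" by (auto simp: inversions_def)
  moreover have "finite ?B" by simp
  ultimately have "card (inversions (Suc n) ?w) = card (inversions n v) + card ?B"
    by (simp add: card_Un_disjoint)
  also have "card ?B = card {a\<in>{1..n}. v a \<in> {m..n}}" by (rule card_image) (auto simp: inj_on_def)
  also have "{a\<in>{1..n}. v a \<in> {m..n}} = v -` {m..n}"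
    using m v by (auto simp: permutes_in_image) (metis atLeastAtMost_iff le_trans permutes_not_in)+
  also have "card \<dots> = card {m..n}"
    by (rule card_vimage_inj) (use permutes_inj[OF v] permutes_surj[OF v] in auto)
  finally show ?thesis by (simp only: card_atLeastAtMost)
qed

lemma exists_word_of_inversions_length:
  "w permutes {1..n} \<Longrightarrow>
     \<exists>is. set is \<subseteq> {1..<n} \<and> w = word_perm is \<and> length is = card (inversions n w)"
proof (induction n arbitrary: w)
  case 0
  hence "w = id" by simp
  thus ?case by (intro exI[of _ "[]"]) (auto simp: inversions_def)
next
  case (Suc n)
  from Suc.prems have "w \<in> (\<lambda>(m, v). top_cycle n m \<circ> v) ` ({1..Suc n} \<times> {v. v permutes {1..n}})"
    unfolding bij_betw_imp_surj_on[OF bij_betw_top_cycle] by simp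
  then obtain m v where mv: "m \<in> {1..Suc n}" "v permutes {1..n}" "w = top_cycle n m \<circ> v"
    by (elim imageE SigmaE) simp
  from Suc.IH[OF mv(2)] obtain "is" where iv: "set is \<subseteq> {1..<n}" "v = word_perm is"
    "length is = card (inversions n v)" by blast
  have "w = word_perm ([m..<Suc n] @ is)" by (simp only: word_perm_append mv(3) iv(2) top_cycle_def)
  moreover have "set ([m..<Suc n] @ is) \<subseteq> {1..<Suc n}" using iv mv by auto
  moreover have "length ([m..<Suc n] @ is) = card (inversions (Suc n) w)"
    using card_inversions_top_cycle[OF mv(1,2)] mv(3) iv(3) by (simp del: upt_Suc)
  ultimately show ?case by blast
qed

lemma perm_length_eq_card_inversions:
  assumes "w permutes {1..n}"
  shows "perm_length n w = card (inversions n w)"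
  unfolding perm_length_def word_perm_def [symmetric]
proof (rule Least_equality)
  show "\<exists>is. length is = card (inversions n w) \<and> set is \<subseteq> {1..<n} \<and> w = word_perm is"
    using exists_word_of_inversions_length[OF assms] by blast
  fix m assume "\<exists>is. length is = m \<and> set is \<subseteq> {1..<n} \<and> w = word_perm is"
  then obtain "is" where "length is = m" "set is \<subseteq> {1..<n}" "w = word_perm is" by blast
  thus "card (inversions n w) \<le> m" using card_inversions_word_perm_le[of "is" n] by simp
qed

lemma W0_eq_prod: "W0 n t = (\<Prod>h=1..n. \<Sum>m<h. t ^ m)"
proof (induction n)
  case 0
  have "perm_length 0 id = 0"
    by (subst perm_length_eq_card_inversions) (simp_all add: permutes_id)
  thus ?case by (simp add: W0_def)
next
  case (Suc n)
  have inv: "W0 n t = (\<Sum>w | w permutes {1..n}. t ^ card (inversions n w))" for n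
    unfolding W0_def by (rule sum.cong) (auto simp: perm_length_eq_card_inversions)
  have "W0 (Suc n) t = (\<Sum>(m, v)\<in>{1..Suc n} \<times> {v. v permutes {1..n}}.
                          t ^ card (inversions (Suc n) (top_cycle n m \<circ> v)))"
    unfolding inv by (subst sum.reindex_bij_betw[OF bij_betw_top_cycle, symmetric]) (simp add: case_prod_unfold)
  also have "\<dots> = (\<Sum>(m, v)\<in>{1..Suc n} \<times> {v. v permutes {1..n}}.
                     t ^ (Suc n - m) * t ^ card (inversions n v))"
    by (rule sum.cong) (auto simp: card_inversions_top_cycle power_add [symmetric] add.commute)
  also have "\<dots> = (\<Sum>m\<in>{1..Suc n}. t ^ (Suc n - m)) * W0 n t"
    unfolding inv sum_product sum.cartesian_product ..
  also have "(\<Sum>m\<in>{1..Suc n}. t ^ (Suc n - m)) = (\<Sum>m<Suc n. t ^ m)"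
    by (rule sum.reindex_bij_witness[of _ "\<lambda>m. Suc n - m" "\<lambda>m. Suc n - m"]) auto
  finally show ?case using Suc by (simp add: mult.commute)
qed

section \<open>Interpolation\<close>

lemma sum_power_div_prod_nodes:
  fixes y :: "nat \<Rightarrow> 'a::field"
  assumes inj: "inj_on y {..d}" and j: "j \<le> d"
  shows "(\<Sum>m\<le>d. y m ^ j / (\<Prod>l\<in>{..d} - {m}. y m - y l)) = (if j = d then 1 else 0)"
proof -
  define L where "L m = (\<Prod>l\<in>{..d} - {m}. [:- y l, 1:])" for m
  define D where "D m = (\<Prod>l\<in>{..d} - {m}. y m - y l)" for m
  define p where "p = (\<Sum>m\<le>d. smult (y m ^ j / D m) (L m))"
  have D: "D m \<noteq> 0" if "m \<le> d" for m
    using that inj by (auto simp: D_def inj_on_def)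
  have degL: "degree (L m) = d" if "m \<le> d" for m
    using that by (simp add: L_def degree_prod_sum_eq)
  have coeffL: "coeff (L m) d = 1" if "m \<le> d" for m
    using lead_coeff_prod[of "\<lambda>l. [:- y l, 1:]" "{..d} - {m}"] degL[OF that] by (simp add: L_def)
  have polyL: "poly (L m) (y l) = (if l = m then D m else 0)" if "m \<le> d" "l \<le> d" for m l
    using that by (auto simp: L_def D_def poly_prod)
  have "p = monom 1 j"
  proof (rule poly_eqI_degree[of "y ` {..d}"])
    have "card (y ` {..d}) = Suc d" using inj by (simp add: card_image)
    moreover have "degree p \<le> d"
      unfolding p_def by (intro degree_sum_le) (auto simp: degL intro: order_trans[OF degree_smult_le])
    ultimately show "card (y ` {..d}) > degree p" "card (y ` {..d}) > degree (monom (1::'a) j)"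
      using j by (auto simp: degree_monom_eq)
    fix x assume "x \<in> y ` {..d}"
    then obtain l where l: "l \<le> d" "x = y l" by auto
    have "poly p x = (\<Sum>m\<le>d. if l = m then y m ^ j else 0)"
      unfolding p_def poly_sum using l D by (intro sum.cong) (auto simp: polyL)
    thus "poly p x = poly (monom 1 j) x" using l by (simp add: poly_monom)
  qed
  hence "coeff p d = coeff (monom 1 j) d" by simp
  also have "coeff p d = (\<Sum>m\<le>d. y m ^ j / D m)"
    unfolding p_def coeff_sum by (intro sum.cong) (auto simp: coeffL)
  finally show ?thesis by (auto simp: D_def)
qed

lemma sum_powi_div_prod_nodes:
  fixes y :: "nat \<Rightarrow> 'a::field" and b :: int
  assumes inj: "inj_on y {..d}" and nz: "\<And>m. m \<le> d \<Longrightarrow> y m \<noteq> 0" and b: "- int d \<le> b" "b \<le> 0"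
  shows "(\<Sum>m\<le>d. y m powi b / (\<Prod>l\<in>{..d} - {m}. 1 - y l / y m)) = (if b = 0 then 1 else 0)"
proof -
  define j where "j = nat (b + int d)"
  have j: "j \<le> d" "b = int j - int d" using b by (auto simp: j_def)
  have "(\<Sum>m\<le>d. y m powi b / (\<Prod>l\<in>{..d} - {m}. 1 - y l / y m)) =
        (\<Sum>m\<le>d. y m ^ j / (\<Prod>l\<in>{..d} - {m}. y m - y l))"
  proof (rule sum.cong)
    fix m assume "m \<in> {..d}"
    hence m: "m \<le> d" by simp
    have "(\<Prod>l\<in>{..d} - {m}. y m - y l) = (\<Prod>l\<in>{..d} - {m}. y m * (1 - y l / y m))"
      using nz[OF m] by (intro prod.cong) (auto simp: field_simps)
    also have "\<dots> = y m ^ d * (\<Prod>l\<in>{..d} - {m}. 1 - y l / y m)"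
      using m by (simp add: prod.distrib)
    finally show "y m powi b / (\<Prod>l\<in>{..d} - {m}. 1 - y l / y m) = y m ^ j / (\<Prod>l\<in>{..d} - {m}. y m - y l)"
      using nz[OF m] by (simp add: j(2) power_int_diff)
  qed simp
  also have "\<dots> = (if b = 0 then 1 else 0)"
    using sum_power_div_prod_nodes[OF inj j(1)] j by auto
  finally show ?thesis .
qed

text \<open>Exponent vectors of total degree 0 either
  vanish or have a negative entry, and a negative entry annihilates the corresponding factor.\<close>

lemma interpolation_monom:
  fixes y :: "nat \<Rightarrow> complex"
  assumes inj: "inj_on y {..d}" and nz: "\<And>m. m \<le> d \<Longrightarrow> y m \<noteq> 0"
    and a: "a \<in> exponents n" "\<And>i. i \<in> {1..n} \<Longrightarrow> - int d \<le> a i" "(\<Sum>i=1..n. a i) = 0"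
  shows "(\<Sum>s\<in>PiE {1..n} (\<lambda>_. {..d}). monom_at n (y \<circ> s) a /
            (\<Prod>i=1..n. \<Prod>l\<in>{..d} - {s i}. 1 - y l / y (s i))) = (if a = (\<lambda>_. 0) then 1 else 0)"
proof -
  have "(\<Sum>s\<in>PiE {1..n} (\<lambda>_. {..d}). monom_at n (y \<circ> s) a /
            (\<Prod>i=1..n. \<Prod>l\<in>{..d} - {s i}. 1 - y l / y (s i))) =
        (\<Sum>s\<in>PiE {1..n} (\<lambda>_. {..d}). \<Prod>i=1..n. y (s i) powi a i /
            (\<Prod>l\<in>{..d} - {s i}. 1 - y l / y (s i)))"
    by (simp add: monom_at_def prod_dividef)
  also have "\<dots> = (\<Prod>i=1..n. \<Sum>m\<le>d. y m powi a i / (\<Prod>l\<in>{..d} - {m}. 1 - y l / y m))"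
    by (rule prod_sum_PiE [symmetric]) auto
  also have "\<dots> = (if a = (\<lambda>_. 0) then 1 else 0)"
  proof (cases "\<exists>i\<in>{1..n}. a i < 0")
    case True
    then obtain i where i: "i \<in> {1..n}" "a i < 0" by blast
    hence "(\<Sum>m\<le>d. y m powi a i / (\<Prod>l\<in>{..d} - {m}. 1 - y l / y m)) = 0"
      using sum_powi_div_prod_nodes[OF inj nz a(2)[OF i(1)]] by auto
    hence "(\<Prod>i=1..n. \<Sum>m\<le>d. y m powi a i / (\<Prod>l\<in>{..d} - {m}. 1 - y l / y m)) = 0"
      using i by (intro prod_zero) auto
    thus ?thesis using i by auto
  next
    case False
    hence "\<forall>i\<in>{1..n}. a i = 0" using a(3) by (subst (asm) sum_nonneg_eq_0_iff) (auto simp: not_less)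
    hence "a = (\<lambda>_. 0)" using a(1) unfolding exponents_def by blast
    thus ?thesis using sum_powi_div_prod_nodes[OF inj nz, of 0] by simp
  qed
  finally show ?thesis .
qed

lemma monom_at_add:
  assumes "\<And>i. i \<in> {1..n} \<Longrightarrow> x i \<noteq> 0"
  shows "monom_at n x (\<lambda>i. a i + b i) = monom_at n x a * monom_at n x b"
  unfolding monom_at_def prod.distrib [symmetric]
  by (rule prod.cong) (use assms in \<open>auto simp: power_int_add\<close>)

definition root_exp :: "nat \<Rightarrow> nat \<Rightarrow> nat \<Rightarrow> int" where
  "root_exp i j l = of_bool (l = i) - of_bool (l = j)"

lemma monom_at_root_exp:
  assumes x: "\<And>l. l \<in> {1..n} \<Longrightarrow> x l \<noteq> 0" and ij: "i \<in> {1..n}" "j \<in> {1..n}"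
  shows "monom_at n x (root_exp i j) = x i / x j"
proof -
  have "monom_at n x (root_exp i j) = (\<Prod>l=1..n. (if l = i then x l else 1) / (if l = j then x l else 1))"
    unfolding monom_at_def root_exp_def using x
    by (intro prod.cong) (auto simp: power_int_minus field_simps)
  thus ?thesis using ij by (simp add: prod_dividef)
qed

lemma monom_at_sum_root_exp:
  assumes x: "\<And>l. l \<in> {1..n} \<Longrightarrow> x l \<noteq> 0"
    and "finite S" "\<And>p. p \<in> S \<Longrightarrow> i p \<in> {1..n} \<and> j p \<in> {1..n}"
  shows "monom_at n x (\<lambda>l. \<Sum>p\<in>S. root_exp (i p) (j p) l) = (\<Prod>p\<in>S. x (i p) / x (j p))"
  using assms(2,3)
proof (induction S rule: finite_induct)
  case (insert p S)
  have "monom_at n x (\<lambda>l. root_exp (i p) (j p) l + (\<Sum>p\<in>S. root_exp (i p) (j p) l)) =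
          x (i p) / x (j p) * (\<Prod>p\<in>S. x (i p) / x (j p))"
    using insert.IH insert.prems x
    by (subst monom_at_add) (simp_all only: monom_at_root_exp insert_iff simp_thms)
  thus ?case using insert.hyps by simp
qed simp

lemma ct_prod_one_minus:
  fixes i j :: "'p \<Rightarrow> nat" and u :: "'p \<Rightarrow> complex" and y :: "nat \<Rightarrow> complex"
  assumes P: "finite P" "\<And>p. p \<in> P \<Longrightarrow> i p \<in> {1..n} \<and> j p \<in> {1..n}"
    and inj: "inj_on y {..d}" and nz: "\<And>m. m \<le> d \<Longrightarrow> y m \<noteq> 0"
    and d: "\<And>l. l \<in> {1..n} \<Longrightarrow> card {p \<in> P. j p = l} \<le> d"
  shows "ct n (\<lambda>x. \<Prod>p\<in>P. 1 - u p * (x (i p) / x (j p))) =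
           (\<Sum>s\<in>PiE {1..n} (\<lambda>_. {..d}). (\<Prod>p\<in>P. 1 - u p * (y (s (i p)) / y (s (j p)))) /
              (\<Prod>i=1..n. \<Prod>l\<in>{..d} - {s i}. 1 - y l / y (s i)))"
proof -
  define e where "e S l = (\<Sum>p\<in>S. root_exp (i p) (j p) l)" for S l
  define v where "v S = (\<Prod>p\<in>S. - u p)" for S
  define c where "c a = (\<Sum>S | S \<subseteq> P \<and> e S = a. v S)" for a
  have finS: "finite S" if "S \<subseteq> P" for S using that P(1) by (rule finite_subset)
  have expand: "(\<Prod>p\<in>P. 1 - u p * (x (i p) / x (j p))) = (\<Sum>S\<in>Pow P. v S * monom_at n x (e S))"
    if x: "\<And>l. l \<in> {1..n} \<Longrightarrow> x l \<noteq> 0" for x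
  proof -
    have "(\<Prod>p\<in>P. 1 - u p * (x (i p) / x (j p))) = (\<Prod>p\<in>P. (- u p) * (x (i p) / x (j p)) + 1)"
      by simp
    also have "\<dots> = (\<Sum>S\<in>Pow P. (\<Prod>p\<in>S. (- u p) * (x (i p) / x (j p))) * (\<Prod>p\<in>P - S. 1))"
      by (rule prod_add) (rule P)
    also have "\<dots> = (\<Sum>S\<in>Pow P. v S * monom_at n x (e S))"
    proof (rule sum.cong)
      fix S assume S: "S \<in> Pow P"
      have "monom_at n x (e S) = (\<Prod>p\<in>S. x (i p) / x (j p))"
        unfolding e_def using S P(2) finS by (intro monom_at_sum_root_exp x) auto
      thus "(\<Prod>p\<in>S. (- u p) * (x (i p) / x (j p))) * (\<Prod>p\<in>P - S. 1) = v S * monom_at n x (e S)"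
        by (simp only: v_def prod.distrib prod.neutral_const mult_1_right)
    qed simp
    finally show ?thesis .
  qed
  have e_exp: "e S \<in> exponents n" if "S \<subseteq> P" for S
    unfolding exponents_def e_def root_exp_def
    by (clarify, rule sum.neutral) (use that P(2) in fastforce)
  have e_sum: "(\<Sum>l=1..n. e S l) = 0" if S: "S \<subseteq> P" for S
  proof -
    have "(\<Sum>l=1..n. e S l) = (\<Sum>p\<in>S. \<Sum>l=1..n. root_exp (i p) (j p) l)"
      unfolding e_def by (rule sum.swap)
    also have "\<dots> = 0"
    proof (rule sum.neutral, rule ballI)
      fix p assume "p \<in> S"
      hence "i p \<in> {1..n}" "j p \<in> {1..n}" using S P(2) by auto
      thus "(\<Sum>l=1..n. root_exp (i p) (j p) l) = 0"
        by (simp add: root_exp_def sum_subtractf of_bool_def)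
    qed
    finally show ?thesis .
  qed
  have e_ge: "- int d \<le> e S l" if S: "S \<subseteq> P" and l: "l \<in> {1..n}" for S l
  proof -
    have "- e S l \<le> (\<Sum>p\<in>S. of_bool (j p = l))"
      unfolding e_def sum_negf [symmetric] by (rule sum_mono) (auto simp: root_exp_def)
    also have "\<dots> \<le> (\<Sum>p\<in>P. of_bool (j p = l))" using S P(1) by (intro sum_mono2) auto
    also have "\<dots> = int (card {p \<in> P. j p = l})"
      using P(1) by (simp add: of_bool_def sum.If_cases Int_def)
    also have "\<dots> \<le> int d" using d[OF l] by simp
    finally show ?thesis by simp
  qed
  have "laurent_expansion n (\<lambda>x. \<Prod>p\<in>P. 1 - u p * (x (i p) / x (j p))) c"
    unfolding laurent_expansion_iff
  proof (intro allI impI, elim conjE)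
    fix x :: "nat \<Rightarrow> complex" assume x: "\<forall>l\<in>{1..n}. norm (x l) = 1"
    have "(\<Sum>S\<in>Pow P. v S * monom_at n x (e S)) =
          (\<Sum>a\<in>e ` Pow P. \<Sum>S\<in>{S \<in> Pow P. e S = a}. v S * monom_at n x (e S))"
      using P(1) by (intro sum.image_gen) simp
    also have "\<dots> = (\<Sum>a\<in>e ` Pow P. c a * monom_at n x a)"
      unfolding c_def sum_distrib_right by (intro sum.cong) auto
    finally have eq: "(\<Prod>p\<in>P. 1 - u p * (x (i p) / x (j p))) = (\<Sum>a\<in>e ` Pow P. c a * monom_at n x a)"
      using x by (subst expand) fastforce+
    have "((\<lambda>a. c a * monom_at n x a) has_sum (\<Prod>p\<in>P. 1 - u p * (x (i p) / x (j p)))) (e ` Pow P)"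
      by (rule has_sum_finiteI) (use P(1) eq in auto)
    moreover have "c a = 0" if "a \<notin> e ` Pow P" for a
      unfolding c_def by (rule sum.neutral) (use that in auto)
    ultimately show "((\<lambda>a. c a * monom_at n x a) has_sum (\<Prod>p\<in>P. 1 - u p * (x (i p) / x (j p)))) (exponents n)"
      by (subst has_sum_cong_neutral[of "e ` Pow P" "exponents n" _ "\<lambda>a. c a * monom_at n x a"])
         (use e_exp in auto)
  qed
  hence "ct n (\<lambda>x. \<Prod>p\<in>P. 1 - u p * (x (i p) / x (j p))) = c (\<lambda>_. 0)" by (rule ct_eqI)
  also have "\<dots> = (\<Sum>S\<in>Pow P. v S * (if e S = (\<lambda>_. 0) then 1 else 0))"
    unfolding c_def using P(1) by (intro sum.mono_neutral_cong_left) auto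
  also have "\<dots> = (\<Sum>S\<in>Pow P. v S * (\<Sum>s\<in>PiE {1..n} (\<lambda>_. {..d}). monom_at n (y \<circ> s) (e S) /
              (\<Prod>i=1..n. \<Prod>l\<in>{..d} - {s i}. 1 - y l / y (s i))))"
    by (intro sum.cong refl, subst interpolation_monom) (use inj nz e_exp e_sum e_ge in auto)
  also have "\<dots> = (\<Sum>s\<in>PiE {1..n} (\<lambda>_. {..d}). (\<Sum>S\<in>Pow P. v S * monom_at n (y \<circ> s) (e S)) /
              (\<Prod>i=1..n. \<Prod>l\<in>{..d} - {s i}. 1 - y l / y (s i)))"
    unfolding sum_distrib_left sum_divide_distrib by (subst sum.swap) simp
  also have "\<dots> = (\<Sum>s\<in>PiE {1..n} (\<lambda>_. {..d}). (\<Prod>p\<in>P. 1 - u p * (y (s (i p)) / y (s (j p)))) /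
              (\<Prod>i=1..n. \<Prod>l\<in>{..d} - {s i}. 1 - y l / y (s i)))"
  proof (rule sum.cong)
    fix s assume s: "s \<in> PiE {1..n} (\<lambda>_. {..d})"
    have "(\<Sum>S\<in>Pow P. v S * monom_at n (y \<circ> s) (e S)) = (\<Prod>p\<in>P. 1 - u p * (y (s (i p)) / y (s (j p))))"
      using s nz by (subst expand [symmetric]) (auto simp del: One_nat_def simp: PiE_iff Pi_iff)
    thus "(\<Sum>S\<in>Pow P. v S * monom_at n (y \<circ> s) (e S)) / (\<Prod>i=1..n. \<Prod>l\<in>{..d} - {s i}. 1 - y l / y (s i)) =
      (\<Prod>p\<in>P. 1 - u p * (y (s (i p)) / y (s (j p)))) / (\<Prod>i=1..n. \<Prod>l\<in>{..d} - {s i}. 1 - y l / y (s i))"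
      by simp
  qed simp
  finally show ?thesis .
qed

section \<open>Evaluation at the interpolation nodes\<close>

lemma prod_lessThan_add:
  "(\<Prod>r<N + k. f r) = (\<Prod>r<N. f r) * (\<Prod>r<k. f (N + r))" for f :: "nat \<Rightarrow> 'a::comm_monoid_mult"
  by (induction k) (auto simp: mult.assoc)

lemma prod_lessThan_mult:
  "(\<Prod>a<c. \<Prod>r<k. f (r + k * a)) = (\<Prod>l<c * k. f l)" for f :: "nat \<Rightarrow> 'a::comm_monoid_mult"
proof (induction c)
  case (Suc c)
  have "(\<Prod>l<Suc c * k. f l) = (\<Prod>l<c * k + k. f l)" by (simp only: mult_Suc add.commute[of k])
  also have "\<dots> = (\<Prod>l<c * k. f l) * (\<Prod>r<k. f (c * k + r))" by (rule prod_lessThan_add)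
  also have "\<dots> = (\<Prod>a<Suc c. \<Prod>r<k. f (r + k * a))"
    unfolding prod.lessThan_Suc Suc.IH by (simp only: add.commute mult.commute)
  finally show ?case ..
qed simp

lemma qpoch_nonzero:
  assumes "norm q < 1"
  shows "qpoch q q m \<noteq> 0"
proof -
  have "q ^ Suc r \<noteq> 1" for r
    using assms power_eq_1_iff[of q "Suc r"] by auto
  thus ?thesis by (auto simp: qpoch_def mult.commute)
qed

lemma inj_power_of_norm_less_1:
  fixes q :: complex
  assumes "q \<noteq> 0" "norm q < 1"
  shows "inj (\<lambda>m::nat. q ^ m)"
proof (rule linorder_injI)
  fix a b :: nat assume "a < b"
  hence "norm q ^ b < norm q ^ a" using assms by (intro power_strict_decreasing) auto
  thus "q ^ a \<noteq> q ^ b" by (metis norm_power less_irrefl)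
qed

lemma gaps_imp_permutation:
  fixes s :: "nat \<Rightarrow> nat"
  assumes n: "n \<ge> 1" and k: "k \<ge> 1"
    and bound: "\<And>i. i \<in> {1..n} \<Longrightarrow> s i \<le> (n - 1) * k"
    and gap: "\<And>i j. i \<in> {1..n} \<Longrightarrow> j \<in> {1..n} \<Longrightarrow> i \<noteq> j \<Longrightarrow> s i \<le> s j \<Longrightarrow> s i + k \<le> s j"
  shows "\<exists>p. p permutes {1..n} \<and> (\<forall>i\<in>{1..n}. s i = k * (p i - 1))"
proof -
  define b where "b i = s i div k" for i
  have b_less: "b i < n" if "i \<in> {1..n}" for i
  proof -
    have "b i \<le> (n - 1) * k div k" unfolding b_def by (intro div_le_mono bound that)
    thus ?thesis using n k by simp
  qed
  have b_mono: "b i < b j" if "i \<in> {1..n}" "j \<in> {1..n}" "i \<noteq> j" "s i \<le> s j" for i j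
  proof -
    have "(s i + k) div k \<le> s j div k" by (intro div_le_mono gap that)
    thus ?thesis using k by (simp add: b_def)
  qed
  have inj: "inj_on b {1..n}"
  proof (rule inj_onI, rule ccontr)
    fix i j assume ij: "i \<in> {1..n}" "j \<in> {1..n}" "b i = b j" "i \<noteq> j"
    show False using b_mono[of i j] b_mono[of j i] ij by (cases "s i \<le> s j") auto
  qed
  have img: "b ` {1..n} = {..<n}"
    using b_less inj by (intro card_subset_eq) (auto simp: card_image)
  have eq: "\<forall>i\<in>{1..n}. b i = m \<longrightarrow> s i = k * m" if "m \<le> n - 1" for m
    using that
  proof (induction m rule: inc_induct)
    case base
    show ?case
    proof (intro ballI impI)
      fix i assume i: "i \<in> {1..n}" "b i = n - 1"
      have "k * b i \<le> s i" by (simp add: b_def)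
      with i bound[OF i(1)] show "s i = k * (n - 1)" by (simp add: mult.commute)
    qed
  next
    case (step m)
    show ?case
    proof (intro ballI impI)
      fix i assume i: "i \<in> {1..n}" "b i = m"
      have "Suc m \<in> b ` {1..n}" unfolding img using step.hyps by simp
      then obtain j where j: "j \<in> {1..n}" "b j = Suc m" by (elim imageE) simp
      with step.IH have sj: "s j = k * Suc m" by blast
      have "s i \<le> s j" using b_mono[OF j(1) i(1)] i j by (cases "s i \<le> s j") auto
      hence "s i + k \<le> s j" using i j by (intro gap) auto
      moreover have "k * b i \<le> s i" by (simp add: b_def)
      ultimately show "s i = k * m" using i sj by simp
    qed
  qed
  define p where "p i = (if i \<in> {1..n} then Suc (b i) else i)" for i
  have "inj_on p {1..n}"
    by (rule inj_onI, rule inj_onD[OF inj]) (simp_all only: p_def if_True nat.inject)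
  moreover have "p ` {1..n} = {1..n}"
  proof -
    have "p ` {1..n} = (\<lambda>i. Suc (b i)) ` {1..n}" by (rule image_cong) (simp_all only: p_def if_True)
    also have "\<dots> = Suc ` (b ` {1..n})" by (simp only: image_image)
    also have "\<dots> = {1..n}" unfolding img by (rule image_Suc_lessThan)
    finally show ?thesis .
  qed
  ultimately have "bij_betw p {1..n} {1..n}" by (simp only: bij_betw_def simp_thms)
  hence "p permutes {1..n}" by (rule bij_imp_permutes) (simp only: p_def if_False)
  moreover have "\<forall>i\<in>{1..n}. s i = k * (p i - 1)"
  proof
    fix i assume i: "i \<in> {1..n}"
    hence "b i \<le> n - 1" using b_less[of i] by simp
    thus "s i = k * (p i - 1)" using eq i by (simp add: p_def)
  qed
  ultimately show ?thesis by blast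
qed

lemma ascending_permutation_eq_id:
  assumes g: "g permutes {1..n::nat}" and asc: "\<And>m. m \<in> {1..<n} \<Longrightarrow> g m < g (Suc m)"
  shows "g = id"
proof -
  have ge: "m \<le> g m" if "1 \<le> m" "m \<le> n" for m
    using that
  proof (induction m rule: dec_induct)
    case base
    hence "g 1 \<in> {1..n}" using g by (simp only: permutes_in_image) simp
    thus ?case by simp
  next
    case (step m)
    thus ?case using asc[of m] by simp
  qed
  have le: "1 \<le> m \<longrightarrow> g m \<le> m" if "m \<le> n" for m
    using that
  proof (induction m rule: inc_induct)
    case base
    have "g n \<in> {1..n}" if "1 \<le> n" using that g by (simp only: permutes_in_image) simp
    thus ?case by simp
  next
    case (step m)
    thus ?case using asc[of m] by auto
  qed
  show ?thesis
  proof
    fix m show "g m = id m"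
      using ge[of m] le[of m] permutes_not_in[OF g, of m] by (cases "m \<in> {1..n}") force+
  qed
qed

definition dyson_index :: "nat \<Rightarrow> nat \<Rightarrow> (nat \<times> nat \<times> nat) set" where
  "dyson_index n k = (SIGMA i:{1..n}. ({1..n} - {i}) \<times> {..<k})"

text \<open>The case \<open>e = 0\<close> is the symmetric weight, \<open>e = 1\<close> the weight of the inner product.\<close>

definition dyson_exp :: "nat \<Rightarrow> nat \<times> nat \<times> nat \<Rightarrow> nat" where
  "dyson_exp e = (\<lambda>(i, j, r). r + (if j < i then e else 0))"

definition dyson_prod :: "nat \<Rightarrow> complex \<Rightarrow> nat \<Rightarrow> nat \<Rightarrow> (nat \<Rightarrow> complex) \<Rightarrow> complex" where
  "dyson_prod n q k e x =
     (\<Prod>p\<in>dyson_index n k. 1 - q ^ dyson_exp e p * (x (fst p) / x (fst (snd p))))"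

lemma finite_dyson_index [simp]: "finite (dyson_index n k)"
  by (simp add: dyson_index_def)

lemma dyson_prod_eq_nested:
  "dyson_prod n q k e x =
     (\<Prod>i=1..n. \<Prod>j\<in>{1..n} - {i}. \<Prod>r<k. 1 - q ^ (r + (if j < i then e else 0)) * (x i / x j))"
  unfolding dyson_prod_def dyson_index_def dyson_exp_def
  by (simp add: prod.Sigma prod.cartesian_product case_prod_unfold)

lemma dyson_prod_nonzero_imp_gap:
  fixes s :: "nat \<Rightarrow> nat"
  assumes q: "q \<noteq> 0" and e: "e \<le> 1" and k: "k \<ge> 1"
    and nz: "dyson_prod n q k e (\<lambda>i. q ^ s i) \<noteq> 0"
    and ij: "i \<in> {1..n}" "j \<in> {1..n}" "i \<noteq> j" "s i \<le> s j"
  shows "s i + k + (if j < i then e else 0) \<le> s j"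
proof (rule ccontr)
  assume gap: "\<not> ?thesis"
  have ne: "s b \<noteq> r + (if b < a then e else 0) + s a"
    if "a \<in> {1..n}" "b \<in> {1..n}" "a \<noteq> b" "r < k" for a b r
  proof
    assume "s b = r + (if b < a then e else 0) + s a"
    hence "1 - q ^ dyson_exp e (a, b, r) * (q ^ s (fst (a, b, r)) / q ^ s (fst (snd (a, b, r)))) = 0"
      using q by (simp add: dyson_exp_def power_add)
    moreover have "(a, b, r) \<in> dyson_index n k" using that by (simp add: dyson_index_def)
    ultimately have "dyson_prod n q k e (\<lambda>i. q ^ s i) = 0"
      unfolding dyson_prod_def by (intro prod_zero bexI[of _ "(a, b, r)"]) simp_all
    with nz show False by simp
  qed
  show False
  proof (cases "s i + (if j < i then e else 0) \<le> s j")
    case True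
    define r where "r = s j - (s i + (if j < i then e else 0))"
    have "s j = r + (if j < i then e else 0) + s i" using True by (simp add: r_def)
    moreover have "r < k" using gap True unfolding r_def by linarith
    ultimately show False using ne[OF ij(1-3)] by blast
  next
    case False
    hence "j < i" "s i = s j" using e ij(4) by (auto split: if_splits)
    with ne[of j i 0] ij k show False by auto
  qed
qed

lemma interpolation_node_ratio:
  fixes b :: nat
  assumes q: "q \<noteq> 0" "norm q < 1" and k: "k \<ge> 1" and b: "b < n"
  shows "(\<Prod>a\<in>{..<n} - {b}. \<Prod>r<k. 1 - q ^ (r + (if b < a then e else 0)) * (q ^ (k * a) / q ^ (k * b))) /
           (\<Prod>l\<in>{..(n - 1) * k} - {k * b}. 1 - q ^ l / q ^ (k * b)) =
         qbinom q ((n - b) * k + e - 1) (k + e - 1)"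
proof -
  define F where "F l = 1 - q ^ l / q ^ (k * b)" for l
  define L where "L = (n - 1 - b) * k"
  have n: "n = Suc b + (n - 1 - b)" using b by simp
  have F: "(\<Prod>l<b * k. F l) \<noteq> 0"
    using injD[OF inj_power_of_norm_less_1[OF q]] q by (auto simp: F_def mult.commute)
  have "(\<Prod>a\<in>{..<n} - {b}. \<Prod>r<k. 1 - q ^ (r + (if b < a then e else 0)) * (q ^ (k * a) / q ^ (k * b))) =
        (\<Prod>a\<in>{..<b} \<union> {Suc b..<n}. \<Prod>r<k. 1 - q ^ (r + (if b < a then e else 0)) * (q ^ (k * a) / q ^ (k * b)))"
    by (rule prod.cong) (use b in auto)
  also have "\<dots> = (\<Prod>a<b. \<Prod>r<k. F (r + k * a)) *
       (\<Prod>a\<in>{Suc b..<n}. \<Prod>r<k. 1 - q ^ (r + e) * (q ^ (k * a) / q ^ (k * b)))"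
    by (subst prod.union_disjoint) (auto simp: F_def power_add)
  also have "(\<Prod>a\<in>{Suc b..<n}. \<Prod>r<k. 1 - q ^ (r + e) * (q ^ (k * a) / q ^ (k * b))) =
        (\<Prod>a<n - 1 - b. \<Prod>r<k. 1 - q ^ (k + e - 1 + (r + k * a)) * q)"
  proof (rule prod.reindex_bij_witness[of _ "\<lambda>a. Suc b + a" "\<lambda>a. a - Suc b"])
    fix a assume a: "a \<in> {Suc b..<n}"
    define c where "c = a - Suc b"
    have a_eq: "a = Suc b + c" using a by (simp add: c_def)
    show "(\<Prod>r<k. 1 - q ^ (k + e - 1 + (r + k * (a - Suc b))) * q) =
            (\<Prod>r<k. 1 - q ^ (r + e) * (q ^ (k * a) / q ^ (k * b)))"
    proof (rule prod.cong)
      fix r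
      have "q ^ (k + e - 1 + (r + k * c)) * q = q ^ (k + e - 1 + (r + k * c) + 1)" by simp
      also have "k + e - 1 + (r + k * c) + 1 = r + e + (k + k * c)" using k by simp
      also have "q ^ (r + e + (k + k * c)) = q ^ (r + e) * (q ^ (k * a) / q ^ (k * b))"
        using q by (simp add: a_eq distrib_left power_add)
      finally show "1 - q ^ (k + e - 1 + (r + k * (a - Suc b))) * q =
            1 - q ^ (r + e) * (q ^ (k * a) / q ^ (k * b))" by (simp add: c_def)
    qed simp
  qed auto
  also have "(\<Prod>a<b. \<Prod>r<k. F (r + k * a)) = (\<Prod>l<b * k. F l)" by (rule prod_lessThan_mult)
  also have "(\<Prod>a<n - 1 - b. \<Prod>r<k. 1 - q ^ (k + e - 1 + (r + k * a)) * q) =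
               (\<Prod>l<L. 1 - q ^ (k + e - 1 + l) * q)"
    unfolding L_def by (rule prod_lessThan_mult)
  finally have num: "(\<Prod>a\<in>{..<n} - {b}. \<Prod>r<k. 1 - q ^ (r + (if b < a then e else 0)) * (q ^ (k * a) / q ^ (k * b))) =
        (\<Prod>l<b * k. F l) * (\<Prod>l<L. 1 - q ^ (k + e - 1 + l) * q)" .
  have nk: "(n - 1) * k = b * k + L" using n unfolding L_def by (metis add_diff_cancel_left' add_mult_distrib diff_Suc_1 add_Suc)
  have "(\<Prod>l\<in>{..(n - 1) * k} - {k * b}. F l) = (\<Prod>l\<in>{..<b * k} \<union> {Suc (b * k)..b * k + L}. F l)"
    unfolding nk by (rule prod.cong) (auto simp: mult.commute[of k])
  also have "\<dots> = (\<Prod>l<b * k. F l) * (\<Prod>l\<in>{Suc (b * k)..b * k + L}. F l)"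
    by (rule prod.union_disjoint) auto
  also have "(\<Prod>l\<in>{Suc (b * k)..b * k + L}. F l) = qpoch q q L"
    unfolding qpoch_def
    by (rule prod.reindex_bij_witness[of _ "\<lambda>l. Suc (b * k) + l" "\<lambda>l. l - Suc (b * k)"])
       (use q in \<open>auto simp: F_def power_diff power_add mult.commute\<close>)
  finally have den: "(\<Prod>l\<in>{..(n - 1) * k} - {k * b}. F l) = (\<Prod>l<b * k. F l) * qpoch q q L" .
  have "(n - b) * k + e - 1 = k + e - 1 + L"
  proof -
    have "n - b = Suc (n - 1 - b)" using b by simp
    hence "(n - b) * k = k + L" unfolding L_def by simp
    thus ?thesis using k by simp
  qed
  moreover have "qpoch q q (k + e - 1 + L) = qpoch q q (k + e - 1) * (\<Prod>l<L. 1 - q ^ (k + e - 1 + l) * q)"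
    unfolding qpoch_def by (rule prod_lessThan_add)
  ultimately have "qbinom q ((n - b) * k + e - 1) (k + e - 1) =
      (\<Prod>l<L. 1 - q ^ (k + e - 1 + l) * q) / qpoch q q L"
    using qpoch_nonzero[OF q(2)] by (simp add: qbinom_def)
  thus ?thesis using F unfolding num F_def [symmetric] den by simp
qed

lemma prod_offdiag_permute:
  fixes f :: "nat \<Rightarrow> nat \<Rightarrow> 'a::comm_monoid_mult"
  assumes p: "p permutes A"
  shows "(\<Prod>i\<in>A. \<Prod>j\<in>A - {i}. f (p i) (p j)) = (\<Prod>i\<in>A. \<Prod>j\<in>A - {i}. f i j)"
proof -
  have "(\<Prod>i\<in>A. \<Prod>j\<in>A - {i}. f i j) = (\<Prod>i\<in>A. \<Prod>j\<in>A - {p i}. f (p i) j)"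
    using p by (rule prod.permute [unfolded comp_def])
  also have "\<dots> = (\<Prod>i\<in>A. \<Prod>j\<in>A - {i}. f (p i) (p j))"
  proof (rule prod.cong)
    fix i assume "i \<in> A"
    have "bij_betw p (A - {i}) (A - {p i})"
      using permutes_imp_bij[OF p] \<open>i \<in> A\<close> by (auto simp: bij_betw_def inj_on_def)
    thus "(\<Prod>j\<in>A - {p i}. f (p i) j) = (\<Prod>j\<in>A - {i}. f (p i) (p j))"
      by (rule prod.reindex_bij_betw [symmetric])
  qed simp
  finally show ?thesis by simp
qed

lemma prod_offdiag_swap:
  fixes f :: "nat \<Rightarrow> nat \<Rightarrow> 'a::comm_monoid_mult"
  assumes "finite A"
  shows "(\<Prod>i\<in>A. \<Prod>j\<in>A - {i}. f i j) = (\<Prod>j\<in>A. \<Prod>i\<in>A - {j}. f i j)"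
proof -
  have "(\<Prod>i\<in>A. \<Prod>j\<in>A - {i}. f i j) = (\<Prod>i\<in>A. \<Prod>j | j \<in> A \<and> i \<noteq> j. f i j)"
    by (intro prod.cong) auto
  also have "\<dots> = (\<Prod>j\<in>A. \<Prod>i | i \<in> A \<and> i \<noteq> j. f i j)"
    by (rule prod.swap_restrict) (use assms in auto)
  also have "\<dots> = (\<Prod>j\<in>A. \<Prod>i\<in>A - {j}. f i j)" by (intro prod.cong) auto
  finally show ?thesis .
qed

lemma interpolation_value:
  assumes q: "q \<noteq> 0" "norm q < 1" and k: "k \<ge> 1" and p: "p permutes {1..n}"
    and e: "e = 0 \<or> p = id"
  shows "dyson_prod n q k e (\<lambda>i. q ^ (k * (p i - 1))) /
           (\<Prod>i=1..n. \<Prod>l\<in>{..(n - 1) * k} - {k * (p i - 1)}. 1 - q ^ l / q ^ (k * (p i - 1))) =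
         (\<Prod>h=1..n. qbinom q (h * k + e - 1) (k + e - 1))"
proof -
  define G where "G a b = (\<Prod>r<k. 1 - q ^ (r + (if b < a then e else 0)) *
                               (q ^ (k * (a - 1)) / q ^ (k * (b - 1))))" for a b
  define H where "H b = (\<Prod>l\<in>{..(n - 1) * k} - {k * (b - 1)}. 1 - q ^ l / q ^ (k * (b - 1)))" for b
  have "dyson_prod n q k e (\<lambda>i. q ^ (k * (p i - 1))) = (\<Prod>i=1..n. \<Prod>j\<in>{1..n} - {i}. G (p i) (p j))"
    unfolding dyson_prod_eq_nested G_def using e by auto
  also have "\<dots> = (\<Prod>i=1..n. \<Prod>j\<in>{1..n} - {i}. G i j)"
    using p by (rule prod_offdiag_permute)
  also have "\<dots> = (\<Prod>b=1..n. \<Prod>a\<in>{1..n} - {b}. G a b)"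
    by (rule prod_offdiag_swap) simp
  finally have num: "dyson_prod n q k e (\<lambda>i. q ^ (k * (p i - 1))) = (\<Prod>b=1..n. \<Prod>a\<in>{1..n} - {b}. G a b)" .
  have den: "(\<Prod>i=1..n. H (p i)) = (\<Prod>b=1..n. H b)"
    using p by (rule prod.permute [unfolded comp_def, symmetric])
  have "(\<Prod>b=1..n. \<Prod>a\<in>{1..n} - {b}. G a b) / (\<Prod>b=1..n. H b) =
        (\<Prod>b=1..n. (\<Prod>a\<in>{1..n} - {b}. G a b) / H b)"
    by (rule prod_dividef [symmetric])
  also have "\<dots> = (\<Prod>b=1..n. qbinom q ((n - (b - 1)) * k + e - 1) (k + e - 1))"
  proof (rule prod.cong)
    fix b assume b: "b \<in> {1..n}"
    have "(\<Prod>a\<in>{1..n} - {b}. G a b) =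
          (\<Prod>a\<in>{..<n} - {b - 1}. \<Prod>r<k. 1 - q ^ (r + (if b - 1 < a then e else 0)) *
                                   (q ^ (k * a) / q ^ (k * (b - 1))))"
      by (rule prod.reindex_bij_witness[of _ Suc "\<lambda>a. a - 1"]) (use b in \<open>auto simp: G_def intro!: prod.cong\<close>)
    thus "(\<Prod>a\<in>{1..n} - {b}. G a b) / H b = qbinom q ((n - (b - 1)) * k + e - 1) (k + e - 1)"
      unfolding H_def using b by (simp only:) (rule interpolation_node_ratio, use q k in auto)
  qed simp
  also have "\<dots> = (\<Prod>h=1..n. qbinom q (h * k + e - 1) (k + e - 1))"
    by (rule prod.reindex_bij_witness[of _ "\<lambda>h. Suc n - h" "\<lambda>h. Suc n - h"]) (auto simp: Suc_diff_le)
  finally show ?thesis unfolding num H_def [symmetric] den .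
qed

lemma ct_dyson_prod:
  assumes q: "q \<noteq> 0" "norm q < 1" and n: "n \<ge> 1" and k: "k \<ge> 1" and e: "e \<le> 1"
  shows "ct n (dyson_prod n q k e) =
           (if e = 0 then fact n else 1) * (\<Prod>h=1..n. qbinom q (h * k + e - 1) (k + e - 1))"
proof -
  define d where "d = (n - 1) * k"
  define V where "V s = dyson_prod n q k e (\<lambda>i. q ^ s i) /
      (\<Prod>i=1..n. \<Prod>l\<in>{..d} - {s i}. 1 - q ^ l / q ^ s i)" for s
  define Q where "Q = (if e = 0 then {p. p permutes {1..n}} else {id})"
  define \<sigma> where "\<sigma> p = restrict (\<lambda>i. k * (p i - 1)) {1..n}" for p :: "nat \<Rightarrow> nat"
  have perm: "p permutes {1..n}" if "p \<in> Q" for p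
    using that by (auto simp: Q_def permutes_id split: if_splits)
  have "ct n (dyson_prod n q k e) = (\<Sum>s\<in>PiE {1..n} (\<lambda>_. {..d}). V s)"
    unfolding dyson_prod_def V_def
  proof (rule ct_prod_one_minus)
    show "inj_on (\<lambda>m. q ^ m) {..d}"
      using inj_power_of_norm_less_1[OF q] by (rule inj_on_subset) simp
    fix l assume l: "l \<in> {1..n}"
    have "{p \<in> dyson_index n k. fst (snd p) = l} = (\<lambda>(i, r). (i, l, r)) ` (({1..n} - {l}) \<times> {..<k})"
      using l by (force simp: dyson_index_def)
    also have "card \<dots> = d"
      using l by (subst card_image) (auto simp: inj_on_def card_cartesian_product d_def)
    finally show "card {p \<in> dyson_index n k. fst (snd p) = l} \<le> d" by simp
  qed (use q in \<open>auto simp: dyson_index_def\<close>)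
  also have "\<dots> = (\<Sum>s\<in>\<sigma> ` Q. V s)"
  proof (rule sum.mono_neutral_right)
    show "\<sigma> ` Q \<subseteq> PiE {1..n} (\<lambda>_. {..d})"
    proof
      fix s assume "s \<in> \<sigma> ` Q"
      then obtain p where p: "p \<in> Q" "s = \<sigma> p" by blast
      have "k * (p i - 1) \<le> d" if "i \<in> {1..n}" for i
      proof -
        have "p i \<in> {1..n}" using perm[OF p(1)] that by (simp only: permutes_in_image)
        hence "p i - 1 \<le> n - 1" by (intro diff_le_mono) simp
        thus ?thesis unfolding d_def by (subst mult.commute) (rule mult_le_mono1)
      qed
      thus "s \<in> PiE {1..n} (\<lambda>_. {..d})" using p by (auto simp: \<sigma>_def)
    qed
    show "\<forall>s\<in>PiE {1..n} (\<lambda>_. {..d}) - \<sigma> ` Q. V s = 0"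
    proof (rule ballI, rule ccontr)
      fix s assume s: "s \<in> PiE {1..n} (\<lambda>_. {..d}) - \<sigma> ` Q" and "V s \<noteq> 0"
      hence "dyson_prod n q k e (\<lambda>i. q ^ s i) \<noteq> 0" by (auto simp: V_def)
      note gap = dyson_prod_nonzero_imp_gap[OF q(1) e k this]
      obtain p where p: "p permutes {1..n}" "\<forall>i\<in>{1..n}. s i = k * (p i - 1)"
        using gaps_imp_permutation[OF n k, of s] s gap unfolding d_def by fastforce
      have s_eq: "s = \<sigma> p"
        using s p(2) by (auto simp: \<sigma>_def fun_eq_iff PiE_def extensional_def)
      have "p \<in> Q"
      proof (cases "e = 0")
        case True
        thus ?thesis using p by (simp add: Q_def)
      next
        case False
        hence e1: "e = 1" using e by simp
        have "inv p = id"
        proof (rule ascending_permutation_eq_id)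
          show ip: "inv p permutes {1..n}" using p by (intro permutes_inv)
          fix m assume m: "m \<in> {1..<n}"
          define a b where "a = inv p m" and "b = inv p (Suc m)"
          have "m \<in> {1..n}" "Suc m \<in> {1..n}" using m by auto
          hence ab: "a \<in> {1..n}" "b \<in> {1..n}"
            unfolding a_def b_def by (simp_all only: permutes_in_image[OF ip])
          have pab: "p a = m" "p b = Suc m" by (simp_all add: a_def b_def permutes_inverses[OF p(1)])
          hence "a \<noteq> b" by auto
          have sab: "s b = k + s a" using p(2) ab pab m by (cases m) auto
          have "s a + k + (if b < a then e else 0) \<le> s b"
            using gap[OF ab \<open>a \<noteq> b\<close>] sab by simp
          hence "\<not> b < a" using sab e1 by (auto split: if_splits)
          with \<open>a \<noteq> b\<close> show "inv p m < inv p (Suc m)" by (simp add: a_def b_def)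
        qed
        hence "p = id" using permutes_inv_inv[OF p(1)] by (metis inv_id)
        thus ?thesis using False by (simp add: Q_def)
      qed
      with s_eq s show False by blast
    qed
  qed (auto intro: finite_PiE)
  also have "\<dots> = (\<Sum>p\<in>Q. V (\<sigma> p))"
  proof (rule sum.reindex [unfolded comp_def])
    show "inj_on \<sigma> Q"
    proof (rule inj_onI)
      fix p p' assume pp: "p \<in> Q" "p' \<in> Q" "\<sigma> p = \<sigma> p'"
      show "p = p'"
      proof
        fix i show "p i = p' i"
        proof (cases "i \<in> {1..n}")
          case True
          hence "p i \<in> {1..n}" "p' i \<in> {1..n}" using pp perm by (simp_all only: permutes_in_image)
          moreover have "k * (p i - 1) = k * (p' i - 1)"
            using True fun_cong[OF pp(3), of i] by (simp only: \<sigma>_def restrict_apply if_True)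
          ultimately show ?thesis using k by auto
        next
          case False
          thus ?thesis using permutes_not_in perm pp by metis
        qed
      qed
    qed
  qed
  also have "\<dots> = (\<Sum>p\<in>Q. \<Prod>h=1..n. qbinom q (h * k + e - 1) (k + e - 1))"
  proof (rule sum.cong)
    fix p assume p: "p \<in> Q"
    have "V (\<sigma> p) = dyson_prod n q k e (\<lambda>i. q ^ (k * (p i - 1))) /
        (\<Prod>i=1..n. \<Prod>l\<in>{..(n - 1) * k} - {k * (p i - 1)}. 1 - q ^ l / q ^ (k * (p i - 1)))"
      unfolding V_def \<sigma>_def dyson_prod_eq_nested d_def
      by (intro arg_cong2[of _ _ _ _ "(/)"] prod.cong refl) auto
    also have "\<dots> = (\<Prod>h=1..n. qbinom q (h * k + e - 1) (k + e - 1))"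
      using p by (intro interpolation_value q k perm) (auto simp: Q_def split: if_splits)
    finally show "V (\<sigma> p) = (\<Prod>h=1..n. qbinom q (h * k + e - 1) (k + e - 1))" .
  qed simp
  also have "\<dots> = of_nat (card Q) * (\<Prod>h=1..n. qbinom q (h * k + e - 1) (k + e - 1))" by simp
  also have "card Q = (if e = 0 then fact n else 1)"
    by (simp add: Q_def card_permutations)
  finally show ?thesis by simp
qed

section \<open>The weights\<close>

lemma prodinf_shift_quotient:
  fixes a :: "nat \<Rightarrow> complex"
  assumes nz: "\<And>r. a r \<noteq> 0" and lim: "a \<longlonglongrightarrow> 1"
  shows "(\<Prod>r. a (r + k) / a r) = 1 / (\<Prod>r<k. a r)"
proof -
  have eq: "(\<Prod>r<N. a (r + k) / a r) = (\<Prod>r<k. a (N + r)) / (\<Prod>r<k. a r)" for N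
  proof -
    have "(\<Prod>r<N. a r) * (\<Prod>r<k. a (N + r)) = (\<Prod>r<k. a r) * (\<Prod>r<N. a (k + r))"
      unfolding prod_lessThan_add [symmetric] by (simp only: add.commute)
    hence "(\<Prod>r<N. a r) * (\<Prod>r<k. a (N + r)) = (\<Prod>r<k. a r) * (\<Prod>r<N. a (r + k))"
      by (simp only: add.commute[of k])
    moreover have "(\<Prod>r<N. a r) \<noteq> 0" "(\<Prod>r<k. a r) \<noteq> 0" using nz by auto
    ultimately show ?thesis unfolding prod_dividef by (simp add: frac_eq_eq mult.commute)
  qed
  have "(\<lambda>N. (\<Prod>r<k. a (N + r)) / (\<Prod>r<k. a r)) \<longlonglongrightarrow> (\<Prod>r<k. 1) / (\<Prod>r<k. a r)"
    by (intro tendsto_divide tendsto_prod tendsto_const LIMSEQ_ignore_initial_segment[OF lim])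
       (simp add: nz)
  hence "(\<lambda>N. \<Prod>r<N. a (r + k) / a r) \<longlonglongrightarrow> 1 / (\<Prod>r<k. a r)" by (simp add: eq)
  hence "(\<lambda>N. \<Prod>r\<le>N. a (r + k) / a r) \<longlonglongrightarrow> 1 / (\<Prod>r<k. a r)"
    by (rule LIMSEQ_lessThan_iff_atMost [THEN iffD1])
  hence "(\<lambda>r. a (r + k) / a r) has_prod (1 / (\<Prod>r<k. a r))"
    unfolding has_prod_def raw_has_prod_def using nz by simp
  thus ?thesis by (simp add: has_prod_unique [symmetric])
qed

lemma prod_offdiag_eq_prod_less:
  fixes g :: "nat \<Rightarrow> nat \<Rightarrow> 'a::comm_monoid_mult"
  shows "(\<Prod>i=1..n. \<Prod>j\<in>{1..n} - {i}. g i j) =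
           (\<Prod>(i, j) | 1 \<le> i \<and> i < j \<and> j \<le> n. g i j * g j i)"
proof -
  define A where "A = {(i, j). 1 \<le> i \<and> i < j \<and> j \<le> n}"
  define B where "B = {(i, j). 1 \<le> j \<and> j < i \<and> i \<le> n}"
  have fin: "finite A" "finite B"
    by (rule finite_subset[of _ "{1..n} \<times> {1..n}"]; auto simp: A_def B_def)+
  have "(\<Prod>i=1..n. \<Prod>j\<in>{1..n} - {i}. g i j) = (\<Prod>(i, j)\<in>(SIGMA i:{1..n}. {1..n} - {i}). g i j)"
    by (rule prod.Sigma) auto
  also have "(SIGMA i:{1..n}. {1..n} - {i}) = A \<union> B"
    unfolding A_def B_def by auto
  also have "(\<Prod>(i, j)\<in>A \<union> B. g i j) = (\<Prod>(i, j)\<in>A. g i j) * (\<Prod>(i, j)\<in>B. g i j)"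
    using fin by (intro prod.union_disjoint) (auto simp: A_def B_def)
  also have "(\<Prod>(i, j)\<in>B. g i j) = (\<Prod>(i, j)\<in>A. g j i)"
    by (rule prod.reindex_bij_witness[of _ prod.swap prod.swap]) (auto simp: A_def B_def)
  also have "(\<Prod>(i, j)\<in>A. g i j) * (\<Prod>(i, j)\<in>A. g j i) = (\<Prod>(i, j)\<in>A. g i j * g j i)"
    unfolding prod.distrib [symmetric] by (simp only: case_prod_unfold)
  finally show ?thesis unfolding A_def .
qed

lemma power_mult_neq_1:
  fixes q z :: complex
  assumes "norm q < 1" "norm z = 1"
  shows "q ^ Suc r * z \<noteq> 1"
proof
  assume "q ^ Suc r * z = 1"
  hence "norm (q ^ Suc r * z) = 1" by (simp only: norm_one)
  hence "norm q ^ Suc r = 1" unfolding norm_mult norm_power assms(2) by (simp only: mult_1_right)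
  thus False using power_eq_1_iff[of "norm q" "Suc r"] assms(1) by simp
qed

lemma prodinf_weight_factor:
  fixes q z :: complex
  assumes q: "norm q < 1" and z: "norm z = 1"
  shows "(\<Prod>r. (1 - q ^ k * q ^ Suc r * z) / (1 - q ^ Suc r * z)) = 1 / (\<Prod>r<k. 1 - q ^ Suc r * z)"
proof -
  have "(\<Prod>r. (1 - q ^ Suc (r + k) * z) / (1 - q ^ Suc r * z)) = 1 / (\<Prod>r<k. 1 - q ^ Suc r * z)"
  proof (rule prodinf_shift_quotient)
    show "1 - q ^ Suc r * z \<noteq> 0" for r
      using power_mult_neq_1[OF q z, of r] unfolding right_minus_eq by (rule not_sym)
    have "(\<lambda>r. q ^ Suc r) \<longlonglongrightarrow> 0" by (intro LIMSEQ_Suc LIMSEQ_power_zero q)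
    from tendsto_diff[OF tendsto_const[of 1] tendsto_mult_left_zero[OF this, of z]]
    show "(\<lambda>r. 1 - q ^ Suc r * z) \<longlonglongrightarrow> 1" by simp
  qed
  thus ?thesis by (simp add: power_add mult_ac)
qed

lemma weight_factor:
  fixes q z :: complex
  assumes q: "norm q < 1" and z: "norm z = 1" "z \<noteq> 1"
  shows "(\<Prod>r<k. 1 - q ^ Suc r * z) * ((1 - z) / (1 - q ^ k * z)) = (\<Prod>r<k. 1 - q ^ r * z)"
proof -
  have "1 - q ^ k * z \<noteq> 0"
    unfolding right_minus_eq
    using not_sym[OF power_mult_neq_1[OF q z(1), of "k - 1"]] z(2) by (cases k) (simp_all only: power_0 mult_1 diff_Suc_1 not_False_eq_True eq_commute)
  moreover have "(\<Prod>r<k. 1 - q ^ r * z) * (1 - q ^ k * z) = (1 - z) * (\<Prod>r<k. 1 - q ^ Suc r * z)"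
    using prod.lessThan_Suc[of "\<lambda>r. 1 - q ^ r * z" k] prod.lessThan_Suc_shift[of "\<lambda>r. 1 - q ^ r * z" k]
    by simp
  ultimately show ?thesis by (simp add: field_simps)
qed

lemma torus_quotient:
  fixes x :: "nat \<Rightarrow> complex"
  assumes "\<forall>i\<in>{1..n}. norm (x i) = 1" "inj_on x {1..n}" "1 \<le> i" "i < j" "j \<le> n"
  shows "norm (x i * inverse (x j)) = 1" "x i * inverse (x j) \<noteq> 1"
    "norm (inverse (x i) * x j) = 1" "inverse (x i) * x j \<noteq> 1" "x i \<noteq> 0" "x j \<noteq> 0"
proof -
  have ij: "i \<in> {1..n}" "j \<in> {1..n}" "i \<noteq> j" using assms by auto
  hence n: "norm (x i) = 1" "norm (x j) = 1" and ne: "x i \<noteq> x j"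
    using assms(1,2) by (auto dest: inj_onD)
  show nz: "x i \<noteq> 0" "x j \<noteq> 0" using n by auto
  show "norm (x i * inverse (x j)) = 1" "norm (inverse (x i) * x j) = 1"
    using n by (simp_all add: norm_mult norm_inverse)
  show "x i * inverse (x j) \<noteq> 1" "inverse (x i) * x j \<noteq> 1"
    using nz ne by (auto simp: field_simps)
qed

lemma weight_eq_dyson_prod_1:
  assumes q: "norm q < 1" and x: "\<forall>i\<in>{1..n}. norm (x i) = 1" "inj_on x {1..n}"
  shows "1 / (Delta_inf n q (q ^ k) x * Delta_0 n (q ^ k) x * Delta_inf n q (q ^ k) (inv_vars x)) =
           dyson_prod n q k 1 x"
proof -
  have "1 / (Delta_inf n q (q ^ k) x * Delta_0 n (q ^ k) x * Delta_inf n q (q ^ k) (inv_vars x)) =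
    (\<Prod>(i, j) | 1 \<le> i \<and> i < j \<and> j \<le> n.
       1 / ((\<Prod>r. (1 - q ^ k * q ^ Suc r * x i * inverse (x j)) / (1 - q ^ Suc r * x i * inverse (x j))) *
         ((1 - q ^ k * x i * inverse (x j)) / (1 - x i * inverse (x j))) *
         (\<Prod>r. (1 - q ^ k * q ^ Suc r * inverse (x i) * inverse (inverse (x j))) /
             (1 - q ^ Suc r * inverse (x i) * inverse (inverse (x j))))))"
    unfolding Delta_inf_def Delta_0_def
    by (simp only: case_prod_unfold prod.distrib prod_dividef prod.neutral_const)
  also have "\<dots> = (\<Prod>(i, j) | 1 \<le> i \<and> i < j \<and> j \<le> n.
       (\<Prod>r<k. 1 - q ^ (r + (if j < i then 1 else 0)) * (x i / x j)) *
       (\<Prod>r<k. 1 - q ^ (r + (if i < j then 1 else 0)) * (x j / x i)))"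
  proof (rule prod.cong, rule refl, clarify)
    fix i j assume ij: "1 \<le> i" "i < j" "j \<le> n"
    note t = torus_quotient[OF x ij]
    have "(\<Prod>r<k. 1 - q ^ r * (x i * inverse (x j))) * (\<Prod>r<k. 1 - q ^ Suc r * (inverse (x i) * x j)) =
       1 / ((\<Prod>r. (1 - q ^ k * q ^ Suc r * (x i * inverse (x j))) / (1 - q ^ Suc r * (x i * inverse (x j)))) *
         ((1 - q ^ k * (x i * inverse (x j))) / (1 - (x i * inverse (x j)))) *
         (\<Prod>r. (1 - q ^ k * q ^ Suc r * (inverse (x i) * x j)) / (1 - q ^ Suc r * (inverse (x i) * x j))))"
      unfolding prodinf_weight_factor[OF q t(1)] prodinf_weight_factor[OF q t(3)]
        weight_factor[OF q t(1,2), symmetric] by simp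
    thus "1 / ((\<Prod>r. (1 - q ^ k * q ^ Suc r * x i * inverse (x j)) / (1 - q ^ Suc r * x i * inverse (x j))) *
         ((1 - q ^ k * x i * inverse (x j)) / (1 - x i * inverse (x j))) *
         (\<Prod>r. (1 - q ^ k * q ^ Suc r * inverse (x i) * inverse (inverse (x j))) /
             (1 - q ^ Suc r * inverse (x i) * inverse (inverse (x j))))) =
       (\<Prod>r<k. 1 - q ^ (r + (if j < i then 1 else 0)) * (x i / x j)) *
       (\<Prod>r<k. 1 - q ^ (r + (if i < j then 1 else 0)) * (x j / x i))"
      using ij by (simp add: divide_inverse mult_ac)
  qed
  also have "\<dots> = dyson_prod n q k 1 x"
    unfolding dyson_prod_eq_nested by (rule prod_offdiag_eq_prod_less [symmetric])
  finally show ?thesis .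
qed

lemma weight_eq_dyson_prod_0:
  assumes q: "norm q < 1" and x: "\<forall>i\<in>{1..n}. norm (x i) = 1" "inj_on x {1..n}"
  shows "1 / (Delta_inf n q (q ^ k) x * Delta_0 n (q ^ k) x *
              Delta_0 n (q ^ k) (inv_vars x) * Delta_inf n q (q ^ k) (inv_vars x)) =
           dyson_prod n q k 0 x"
proof -
  have "1 / (Delta_inf n q (q ^ k) x * Delta_0 n (q ^ k) x *
             Delta_0 n (q ^ k) (inv_vars x) * Delta_inf n q (q ^ k) (inv_vars x)) =
        dyson_prod n q k 1 x * (1 / Delta_0 n (q ^ k) (inv_vars x))"
    unfolding weight_eq_dyson_prod_1[OF assms, symmetric] by simp
  also have "1 / Delta_0 n (q ^ k) (inv_vars x) = (\<Prod>(i, j) | 1 \<le> i \<and> i < j \<and> j \<le> n.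
      (1 - inverse (x i) * inverse (inverse (x j))) / (1 - q ^ k * inverse (x i) * inverse (inverse (x j))))"
    unfolding Delta_0_def by (simp add: case_prod_unfold prod_dividef)
  also have "dyson_prod n q k 1 x * \<dots> = (\<Prod>(i, j) | 1 \<le> i \<and> i < j \<and> j \<le> n.
       (\<Prod>r<k. 1 - q ^ (r + (if j < i then 1 else 0)) * (x i / x j)) *
       (\<Prod>r<k. 1 - q ^ (r + (if i < j then 1 else 0)) * (x j / x i)) *
       ((1 - inverse (x i) * inverse (inverse (x j))) / (1 - q ^ k * inverse (x i) * inverse (inverse (x j)))))"
    unfolding dyson_prod_eq_nested prod_offdiag_eq_prod_less by (simp only: case_prod_unfold prod.distrib)
  also have "\<dots> = (\<Prod>(i, j) | 1 \<le> i \<and> i < j \<and> j \<le> n.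
       (\<Prod>r<k. 1 - q ^ (r + (if j < i then 0 else 0)) * (x i / x j)) *
       (\<Prod>r<k. 1 - q ^ (r + (if i < j then 0 else 0)) * (x j / x i)))"
  proof (rule prod.cong, rule refl, clarify)
    fix i j assume ij: "1 \<le> i" "i < j" "j \<le> n"
    note t = torus_quotient[OF x ij]
    have "(\<Prod>r<k. 1 - q ^ Suc r * (x j / x i)) *
       ((1 - inverse (x i) * inverse (inverse (x j))) / (1 - q ^ k * inverse (x i) * inverse (inverse (x j)))) =
       (\<Prod>r<k. 1 - q ^ r * (x j / x i))"
      using weight_factor[OF q t(3,4), of k] by (simp add: divide_inverse mult_ac)
    thus "(\<Prod>r<k. 1 - q ^ (r + (if j < i then 1 else 0)) * (x i / x j)) *
       (\<Prod>r<k. 1 - q ^ (r + (if i < j then 1 else 0)) * (x j / x i)) *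
       ((1 - inverse (x i) * inverse (inverse (x j))) / (1 - q ^ k * inverse (x i) * inverse (inverse (x j)))) =
       (\<Prod>r<k. 1 - q ^ (r + (if j < i then 0 else 0)) * (x i / x j)) *
       (\<Prod>r<k. 1 - q ^ (r + (if i < j then 0 else 0)) * (x j / x i))"
      using ij not_less_iff_gr_or_eq[of j i] by (simp only: simp_thms if_True if_False add_0_right Suc_eq_plus1 [symmetric] mult.assoc)
  qed
  also have "\<dots> = dyson_prod n q k 0 x"
    unfolding dyson_prod_eq_nested by (rule prod_offdiag_eq_prod_less [symmetric])
  finally show ?thesis .
qed

lemma ct_dyson_prod_0: "ct n (dyson_prod n q 0 e) = 1"
proof -
  have "laurent_expansion n (dyson_prod n q 0 e) (\<lambda>a. if a = (\<lambda>_. 0) then 1 else 0)"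
    unfolding laurent_expansion_iff
  proof (intro allI impI)
    fix x :: "nat \<Rightarrow> complex"
    have "((\<lambda>a. (if a = (\<lambda>_. 0) then 1 else 0) * monom_at n x a) has_sum dyson_prod n q 0 e x) {\<lambda>_. 0}"
      by (rule has_sum_finiteI) (simp_all add: dyson_prod_def dyson_index_def)
    thus "((\<lambda>a. (if a = (\<lambda>_. 0) then 1 else 0) * monom_at n x a) has_sum dyson_prod n q 0 e x) (exponents n)"
      by (rule has_sum_cong_neutral[THEN iffD1, rotated -1]) (auto simp: zero_in_exponents)
  qed
  from ct_eqI[OF this] show ?thesis by simp
qed

lemma qbinom_self:
  assumes "norm q < 1"
  shows "qbinom q m m = 1"
  using qpoch_nonzero[OF assms, of m] by (simp add: qbinom_def qpoch_def)

lemma qbinom_absorption: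
  assumes q: "norm q < 1" and k: "k \<ge> 1" and h: "h \<ge> 1"
  shows "qbinom q (h * k) k * (1 - q ^ k) = qbinom q (h * k - 1) (k - 1) * (1 - q ^ (h * k))"
proof -
  have suc: "qpoch q q m = qpoch q q (m - 1) * (1 - q ^ m)" if "m \<ge> 1" for m
    using that by (cases m) (simp_all add: qpoch_def mult.commute)
  have kk: "k \<le> h * k" using h by simp
  have "1 - q ^ k \<noteq> 0" using power_eq_1_iff[of q k] q k by auto
  moreover have "h * k - 1 - (k - 1) = h * k - k" using k by simp
  ultimately show ?thesis
    using k h kk by (simp add: qbinom_def suc[of k] suc[of "h * k"])
qed

lemma prod_qbinom_eq_W0:
  assumes q: "norm q < 1" and k: "k \<ge> 1"
  shows "(\<Prod>h=1..n. qbinom q (h * k) k) = W0 n (q ^ k) * (\<Prod>h=1..n. qbinom q (h * k - 1) (k - 1))"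
    and "W0 n (q ^ k) \<noteq> 0"
proof -
  have ne: "q ^ m \<noteq> 1" if "m \<ge> 1" for m using power_eq_1_iff[of q m] q that by auto
  have geo: "(\<Sum>m<h. (q ^ k) ^ m) = (1 - q ^ (h * k)) / (1 - q ^ k)" for h
    using sum_gp_strict[of "q ^ k" h] ne[OF k] by (simp add: power_mult [symmetric] mult.commute)
  have "(\<Prod>h=1..n. qbinom q (h * k) k) =
          (\<Prod>h=1..n. (\<Sum>m<h. (q ^ k) ^ m) * qbinom q (h * k - 1) (k - 1))"
  proof (rule prod.cong)
    fix h assume "h \<in> {1..n}"
    hence "qbinom q (h * k) k * (1 - q ^ k) = qbinom q (h * k - 1) (k - 1) * (1 - q ^ (h * k))"
      using qbinom_absorption[OF q k] by simp
    thus "qbinom q (h * k) k = (\<Sum>m<h. (q ^ k) ^ m) * qbinom q (h * k - 1) (k - 1)"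
      unfolding geo using ne[OF k] by (simp add: field_simps)
  qed simp
  thus "(\<Prod>h=1..n. qbinom q (h * k) k) = W0 n (q ^ k) * (\<Prod>h=1..n. qbinom q (h * k - 1) (k - 1))"
    by (simp only: W0_eq_prod prod.distrib)
  show "W0 n (q ^ k) \<noteq> 0"
    unfolding W0_eq_prod geo using ne k by (auto simp: Suc_le_eq)
qed

theorem proposition7p6:
  fixes n k :: nat and q t :: complex
  assumes "n \<ge> 1" and "q \<noteq> 0" and "norm q < 1" and "t = q ^ k"
  shows "(qt_inner n q t (\<lambda>_ _ _. 1) (\<lambda>_ _ _. 1) =
           ct n (\<lambda>x. 1 / (Delta_inf n q t x * Delta_0 n t x * Delta_inf n q t (inv_vars x)))) \<and>
    (ct n (\<lambda>x. 1 / (Delta_inf n q t x * Delta_0 n t x * Delta_inf n q t (inv_vars x))) =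
           (\<Prod>i=2..n. qbinom q (i * k) k)) \<and>
    (1 / W0 n t * qt_inner n q t (\<lambda>_ _ _. 1) (\<lambda>_ _ _. 1) =
           1 / fact n *
           ct n (\<lambda>x. 1 / (Delta_inf n q t x * Delta_0 n t x *
                          Delta_0 n t (inv_vars x) * Delta_inf n q t (inv_vars x)))) \<and>
    (k \<ge> 1 \<longrightarrow>
         1 / fact n *
           ct n (\<lambda>x. 1 / (Delta_inf n q t x * Delta_0 n t x *
                          Delta_0 n t (inv_vars x) * Delta_inf n q t (inv_vars x))) =
           (\<Prod>h=2..n. qbinom q (h * k - 1) (k - 1)))"
proof -
  define c1 where "c1 = ct n (\<lambda>x. 1 / (Delta_inf n q t x * Delta_0 n t x * Delta_inf n q t (inv_vars x)))"
  define c0 where "c0 = ct n (\<lambda>x. 1 / (Delta_inf n q t x * Delta_0 n t x *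
                          Delta_0 n t (inv_vars x) * Delta_inf n q t (inv_vars x)))"
  have inner: "qt_inner n q t (\<lambda>_ _ _. 1) (\<lambda>_ _ _. 1) = c1"
    by (simp add: qt_inner_def bar_def c1_def)
  have c1: "c1 = ct n (dyson_prod n q k 1)"
    unfolding c1_def \<open>t = q ^ k\<close> by (intro ct_cong weight_eq_dyson_prod_1 assms)
  have c0: "c0 = ct n (dyson_prod n q k 0)"
    unfolding c0_def \<open>t = q ^ k\<close> by (intro ct_cong weight_eq_dyson_prod_0 assms)
  have from2: "(\<Prod>h=1..n. f h) = f 1 * (\<Prod>h=2..n. f h)" for f :: "nat \<Rightarrow> complex"
    using \<open>n \<ge> 1\<close> by (simp add: prod.atLeast_Suc_atMost numeral_2_eq_2)
  have "c1 = (\<Prod>i=2..n. qbinom q (i * k) k) \<and> 1 / W0 n t * c1 = 1 / fact n * c0 \<and>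
        (k \<ge> 1 \<longrightarrow> 1 / fact n * c0 = (\<Prod>h=2..n. qbinom q (h * k - 1) (k - 1)))"
  proof (cases "k \<ge> 1")
    case True
    have c1_val: "c1 = (\<Prod>h=1..n. qbinom q (h * k) k)"
      unfolding c1 ct_dyson_prod[OF assms(2,3,1) True order_refl] by simp
    have c0_val: "c0 = fact n * (\<Prod>h=1..n. qbinom q (h * k - 1) (k - 1))"
      unfolding c0 ct_dyson_prod[OF assms(2,3,1) True zero_le] by simp
    have "1 / W0 n t * c1 = 1 / fact n * c0"
      unfolding c1_val c0_val prod_qbinom_eq_W0(1)[OF assms(3) True] \<open>t = q ^ k\<close>
      using prod_qbinom_eq_W0(2)[OF assms(3) True, of n] by simp
    moreover have "c1 = (\<Prod>i=2..n. qbinom q (i * k) k)"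
      unfolding c1_val from2 by (simp add: qbinom_self assms)
    moreover have "1 / fact n * c0 = (\<Prod>h=2..n. qbinom q (h * k - 1) (k - 1))"
      unfolding c0_val from2 by (simp add: qbinom_self assms)
    ultimately show ?thesis by blast
  next
    case False
    hence "k = 0" by simp
    have "W0 n 1 = fact n" by (simp add: W0_def card_permutations)
    thus ?thesis
      using \<open>k = 0\<close> by (simp add: c0 c1 ct_dyson_prod_0 qbinom_self assms)
  qed
  thus ?thesis unfolding inner c1_def c0_def by blast
qed

end
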